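(* Let $X:M\to\mathbb{R}^{n+1}$ be a complete and non-compact properly immersed $\lambda$-hypersurface in the Euclidean space $\mathbb{R}^{n+1}$. Then there is a positive constant $C$ such that for $r\ge1$, $$\mathrm{Area}(B_r(0)\cap X(M))=\int_{B_r(0)\cap X(M)}d\mu\le C\,r^{\,n+\frac{\lambda^2}{2}-2\beta-\frac{\inf H^2}{2}},$$ where $\beta=\frac14\inf(\lambda-H)^2$.
   Context: $X:M\to\mathbb{R}^{n+1}$ is a smooth immersion of a connected $n$-dimensional manifold with unit normal $N$ and induced area element $d\mu$. The second fundamental form is $h_{ij}=-\langle D_{e_i}N,e_j\rangle$ for a local orthonormal tangent frame ($D$ the Euclidean derivative) and $H=\sum_i h_{ii}$. For a constant $\lambda\in\mathbb{R}$, $X$ is a $\lambda$-hypersurface if $\langle X,N\rangle+H=\lambda$ on $M$. $B_r(0)$ is the Euclidean ball of radius $r$ centered at the origin, and the integral over $B_r(0)\cap X(M)$ means the integral over $\{p\in M:|X(p)|<r\}$. Infima are over $M$. *)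

theory Defs
  imports "HOL-Analysis.Analysis"
begin

text \<open>
  A manifold is a Hausdorff, second countable type together with a smooth atlas; its dimension is
  \<open>CARD('n)\<close>.  A chart is a pair of a domain and a coordinate map, whose values outside the domain
  are irrelevant.
\<close>

type_synonym ('m, 'n) chart = "'m set \<times> ('m \<Rightarrow> real ^ 'n)"

definition chart_inv :: "('m, 'n::finite) chart \<Rightarrow> real ^ 'n \<Rightarrow> 'm" where
  "chart_inv c = inv_into (fst c) (snd c)"

text \<open>\<open>Ck_on\<close> and \<open>smooth_on\<close> are only meant for open sets.\<close>

primrec Ck_on ::
  "nat \<Rightarrow> ('a::euclidean_space \<Rightarrow> 'b::real_normed_vector) \<Rightarrow> 'a set \<Rightarrow> bool" where
  "Ck_on 0 = (\<lambda>f S. continuous_on S f)"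
| "Ck_on (Suc k) = (\<lambda>f S. f differentiable_on S \<and>
      (\<forall>b\<in>Basis. Ck_on k (\<lambda>x. frechet_derivative f (at x) b) S))"

definition smooth_on ::
  "('a::euclidean_space \<Rightarrow> 'b::real_normed_vector) \<Rightarrow> 'a set \<Rightarrow> bool" where
  "smooth_on f S \<longleftrightarrow> (\<forall>k. Ck_on k f S)"

definition smooth_atlas :: "('m::topological_space, 'n::finite) chart set \<Rightarrow> bool" where
  "smooth_atlas A \<longleftrightarrow>
     (\<Union>c\<in>A. fst c) = UNIV \<and>
     (\<forall>c\<in>A. open (fst c) \<and> open (snd c ` fst c) \<and>
        homeomorphism (fst c) (snd c ` fst c) (snd c) (chart_inv c)) \<and>
     (\<forall>c\<in>A. \<forall>d\<in>A. smooth_on (snd d \<circ> chart_inv c) (snd c ` (fst c \<inter> fst d)))"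

definition smooth_map ::
  "('m, 'n::finite) chart set \<Rightarrow> ('m \<Rightarrow> 'b::real_normed_vector) \<Rightarrow> bool" where
  "smooth_map A f \<longleftrightarrow> (\<forall>c\<in>A. smooth_on (f \<circ> chart_inv c) (snd c ` fst c))"

text \<open>
  The differential of \<open>f\<close> at \<open>p\<close>; tangent vectors are represented by their components in the
  chart \<open>c\<close>.
\<close>

definition chart_deriv ::
  "('m, 'n::finite) chart \<Rightarrow> ('m \<Rightarrow> 'b::real_normed_vector) \<Rightarrow> 'm \<Rightarrow> real ^ 'n \<Rightarrow> 'b" where
  "chart_deriv c f p = frechet_derivative (f \<circ> chart_inv c) (at (snd c p))"

definition smooth_immersion ::
  "('m, 'n::finite) chart set \<Rightarrow> ('m \<Rightarrow> 'e::euclidean_space) \<Rightarrow> bool" where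
  "smooth_immersion A X \<longleftrightarrow>
     smooth_map A X \<and> (\<forall>c\<in>A. \<forall>p\<in>fst c. inj (chart_deriv c X p))"

definition unit_normal ::
  "('m, 'n::finite) chart set \<Rightarrow> ('m \<Rightarrow> 'e::euclidean_space) \<Rightarrow> ('m \<Rightarrow> 'e) \<Rightarrow> bool" where
  "unit_normal A X N \<longleftrightarrow>
     smooth_map A N \<and> (\<forall>p. norm (N p) = 1) \<and>
     (\<forall>c\<in>A. \<forall>p\<in>fst c. \<forall>v. N p \<bullet> chart_deriv c X p v = 0)"

definition induced_metric ::
  "('m, 'n::finite) chart \<Rightarrow> ('m \<Rightarrow> 'e::euclidean_space) \<Rightarrow> 'm \<Rightarrow> real ^ 'n \<Rightarrow> real ^ 'n \<Rightarrow> real" where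
  "induced_metric c X p v w = chart_deriv c X p v \<bullet> chart_deriv c X p w"

definition second_ff ::
  "('m, 'n::finite) chart \<Rightarrow> ('m \<Rightarrow> 'e::euclidean_space) \<Rightarrow> ('m \<Rightarrow> 'e) \<Rightarrow> 'm \<Rightarrow>
    real ^ 'n \<Rightarrow> real ^ 'n \<Rightarrow> real" where
  "second_ff c X N p v w = - (chart_deriv c N p v \<bullet> chart_deriv c X p w)"

definition orthonormal_frame ::
  "('m, 'n::finite) chart \<Rightarrow> ('m \<Rightarrow> 'e::euclidean_space) \<Rightarrow> 'm \<Rightarrow> ('n \<Rightarrow> real ^ 'n) \<Rightarrow> bool" where
  "orthonormal_frame c X p e \<longleftrightarrow>
     (\<forall>i j. induced_metric c X p (e i) (e j) = (if i = j then 1 else 0))"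

text \<open>
  The trace of the second fundamental form does not depend on the chart and the orthonormal frame
  in which it is computed, so any choice of these may be used.
\<close>

definition mean_curvature ::
  "('m, 'n::finite) chart set \<Rightarrow> ('m \<Rightarrow> 'e::euclidean_space) \<Rightarrow> ('m \<Rightarrow> 'e) \<Rightarrow> 'm \<Rightarrow> real" where
  "mean_curvature A X N p =
     (SOME H. \<exists>c\<in>A. \<exists>e. p \<in> fst c \<and> orthonormal_frame c X p e \<and>
        H = (\<Sum>i\<in>UNIV. second_ff c X N p (e i) (e i)))"

definition lambda_hypersurface ::
  "('m, 'n::finite) chart set \<Rightarrow> ('m \<Rightarrow> 'e::euclidean_space) \<Rightarrow> ('m \<Rightarrow> 'e) \<Rightarrow> real \<Rightarrow> bool" where
  "lambda_hypersurface A X N l \<longleftrightarrow> (\<forall>p. X p \<bullet> N p + mean_curvature A X N p = l)"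

text \<open>
  Curves need not be regular, so piecewise continuously differentiable curves can be
  reparametrized to continuously differentiable ones of the same length (stopping at the corners);
  the infimum of the lengths is the usual Riemannian distance.
\<close>

definition C1_curve :: "('m::topological_space, 'n::finite) chart set \<Rightarrow> (real \<Rightarrow> 'm) \<Rightarrow> bool" where
  "C1_curve A g \<longleftrightarrow>
     continuous_on {0..1} g \<and>
     (\<forall>c\<in>A. \<exists>g'. continuous_on {t \<in> {0..1}. g t \<in> fst c} g' \<and>
        (\<forall>t\<in>{0..1}. g t \<in> fst c \<longrightarrow>
           ((snd c \<circ> g) has_vector_derivative g' t) (at t within {0..1})))"

text \<open>
  In the metric induced by \<open>X\<close>, the speed of a curve is the Euclidean speed of its image
  under \<open>X\<close>.
\<close>

definition curve_length :: "('m \<Rightarrow> 'e::euclidean_space) \<Rightarrow> (real \<Rightarrow> 'm) \<Rightarrow> real" where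
  "curve_length X g =
     integral {0..1} (\<lambda>t. norm (vector_derivative (X \<circ> g) (at t within {0..1})))"

definition riemannian_dist ::
  "('m::topological_space, 'n::finite) chart set \<Rightarrow> ('m \<Rightarrow> 'e::euclidean_space) \<Rightarrow> 'm \<Rightarrow> 'm \<Rightarrow> real"
where
  "riemannian_dist A X p q =
     Inf (curve_length X ` {g. C1_curve A g \<and> g 0 = p \<and> g 1 = q})"

definition complete_immersion ::
  "('m::topological_space, 'n::finite) chart set \<Rightarrow> ('m \<Rightarrow> 'e::euclidean_space) \<Rightarrow> bool" where
  "complete_immersion A X \<longleftrightarrow> Metric_space.mcomplete UNIV (riemannian_dist A X)"

definition proper_immersion :: "('m::topological_space \<Rightarrow> 'e::euclidean_space) \<Rightarrow> bool" where
  "proper_immersion X \<longleftrightarrow> (\<forall>K. compact K \<longrightarrow> compact (X -` K))"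

definition area_density ::
  "('m, 'n::finite) chart \<Rightarrow> ('m \<Rightarrow> 'e::euclidean_space) \<Rightarrow> 'm \<Rightarrow> real" where
  "area_density c X p = sqrt (det (\<chi> i j. induced_metric c X p (axis i 1) (axis j 1)))"

text \<open>
  The measure with area element \<open>sqrt (det g) dx\<close> in every chart.  These local measures agree
  on overlaps by the change of variables formula, and countably many chart domains cover the
  manifold, so there is exactly one such measure.
\<close>

definition is_area_measure ::
  "('m::topological_space, 'n::finite) chart set \<Rightarrow> ('m \<Rightarrow> 'e::euclidean_space) \<Rightarrow> 'm measure \<Rightarrow> bool"
where
  "is_area_measure A X \<mu> \<longleftrightarrow>
     sets \<mu> = sets borel \<and>
     (\<forall>c\<in>A. \<forall>B\<in>sets borel. B \<subseteq> fst c \<longrightarrow>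
        emeasure \<mu> B =
          (\<integral>\<^sup>+x\<in>snd c ` B. ennreal (area_density c X (chart_inv c x)) \<partial>lborel))"

end

theory Submission
  imports Defs
begin

text \<open>
  Put \<open>f = |X|\<^sup>2 / 4\<close> and \<open>k = (n + \<lambda>\<^sup>2/2 - 2\<beta> - inf H\<^sup>2/2) / 2\<close>, half of the exponent in the theorem.
  Since \<open>\<Delta>X = H N\<close> and \<open>\<langle>X, N\<rangle> = \<lambda> - H\<close>, one has \<open>\<Delta>f = (n + H (\<lambda> - H)) / 2\<close> and
  \<open>|\<nabla>f|\<^sup>2 = f - (\<lambda> - H)\<^sup>2 / 4\<close>.  Hence \<open>y = f - \<beta>\<close> satisfies \<open>0 \<le> |\<nabla>f|\<^sup>2 \<le> y\<close>, and for
  \<open>0 < \<tau> \<le> 1\<close>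
    \<open>\<Delta>f - \<tau> |\<nabla>f|\<^sup>2 + \<tau> y \<le> \<Delta>f - |\<nabla>f|\<^sup>2 + y \<le> k\<close>   (\<open>drift_laplacian_le\<close>).

  Let \<open>\<eta>\<^sub>s = (1 - f/s)\<^sup>2\<close> where \<open>f < s\<close> and \<open>0\<close> elsewhere.  It has compact support because \<open>X\<close> is
  proper, and it decreases in \<open>f\<close>.  The divergence theorem for the field \<open>\<eta>\<^sub>s e\<^sup>-\<^sup>\<tau>\<^sup>y \<nabla>f\<close>, together
  with the inequality above, gives
    \<open>\<tau> \<integral> \<eta>\<^sub>s y e\<^sup>-\<^sup>\<tau>\<^sup>y \<le> k \<integral> \<eta>\<^sub>s e\<^sup>-\<^sup>\<tau>\<^sup>y\<close>   (\<open>weighted_moment_le\<close>).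
  This says that \<open>\<tau>\<^sup>k J\<^sub>s(\<tau>)\<close> increases on \<open>(0, 1]\<close>, where \<open>J\<^sub>s(\<tau>) = \<integral> \<eta>\<^sub>s e\<^sup>-\<^sup>\<tau>\<^sup>y\<close>; therefore
  \<open>J\<^sub>s(\<tau>) \<le> \<tau>\<^sup>-\<^sup>k J\<^sub>s(1)\<close> (\<open>exponential_weight_bound\<close>).

  The same inequality bounds \<open>J\<^sub>s(1)\<close> independently of \<open>s\<close>: splitting at a level \<open>L\<close> of \<open>y\<close>,
  \<open>J\<^sub>s(1) \<le> Area{y \<le> L} + e\<^sup>-\<^sup>L\<^sup>/\<^sup>2 J\<^sub>s(1/2) \<le> Area{y \<le> L} + e\<^sup>-\<^sup>L\<^sup>/\<^sup>2 2\<^sup>k J\<^sub>s(1)\<close>, and the last term is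
  absorbed when \<open>L\<close> is large.  On the ball of radius \<open>r\<close> the integrand of \<open>J\<^sub>s(\<tau>)\<close> with
  \<open>s = r\<^sup>2/2\<close> and \<open>\<tau> = r\<^sup>-\<^sup>2\<close> is bounded below by a constant, so the area of the ball is at most a
  constant times \<open>\<tau>\<^sup>-\<^sup>k = r\<^sup>2\<^sup>k\<close> (\<open>area_growth\<close>).

  The geometric input is the divergence theorem for \<open>\<phi> \<nabla>f\<close>.  In a chart, \<open>\<nabla>f\<close> has a coordinate
  vector \<open>a\<close> determined by \<open>dY(a) = (Y - \<langle>Y, \<nu>\<rangle> \<nu>) / 2\<close>.  Differentiating this equation along an
  orthonormal frame and taking the trace gives the divergence of the area density times \<open>a\<close>
  (\<open>divergence_half_tangent\<close>), and the integral of a divergence with compact support vanishes.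
  Products with finitely many plateau functions supported in charts globalize the statement
  (\<open>divergence_theorem\<close>).
\<close>

section \<open>Continuously differentiable functions\<close>

text \<open>
  Partial derivatives in all directions replace a continuous total derivative: they are what the
  smoothness notion for charts provides, and they avoid the space of bounded linear maps.
\<close>

definition C1 :: "('a::euclidean_space \<Rightarrow> 'b::real_normed_vector) \<Rightarrow> 'a set \<Rightarrow> bool" where
  "C1 f S \<longleftrightarrow> (\<forall>x\<in>S. f differentiable (at x)) \<and>
     (\<forall>v. continuous_on S (\<lambda>x. frechet_derivative f (at x) v))"

lemma C1I:
  assumes "\<And>x. x \<in> S \<Longrightarrow> (f has_derivative f' x) (at x)"
    and "\<And>v. continuous_on S (\<lambda>x. f' x v)"
  shows "C1 f S"
proof -
  have "frechet_derivative f (at x) = f' x" if "x \<in> S" for x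
    using frechet_derivative_at[OF assms(1)[OF that]] by simp
  then show ?thesis
    unfolding C1_def using assms by (auto simp: differentiable_def cong: continuous_on_cong)
qed

lemma C1_has_derivative:
  "C1 f S \<Longrightarrow> x \<in> S \<Longrightarrow> (f has_derivative frechet_derivative f (at x)) (at x)"
  by (simp add: C1_def frechet_derivative_works)

lemma C1_continuous_derivative:
  "C1 f S \<Longrightarrow> continuous_on S (\<lambda>x. frechet_derivative f (at x) v)"
  by (simp add: C1_def)

lemma C1_continuous_on: "C1 f S \<Longrightarrow> continuous_on S f"
  by (meson C1_has_derivative continuous_at_imp_continuous_on has_derivative_continuous)

lemma C1_cong:
  assumes "C1 f S" "open S" "\<And>x. x \<in> S \<Longrightarrow> g x = f x"
  shows "C1 g S"
proof (rule C1I)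
  fix x assume "x \<in> S"
  then show "(g has_derivative frechet_derivative f (at x)) (at x)"
    using has_derivative_transform_within_open[OF C1_has_derivative[OF assms(1)]] assms(2,3)
    by metis
qed (rule C1_continuous_derivative[OF assms(1)])

lemma C1_union:
  assumes "C1 f S" "C1 f T" "open S" "open T"
  shows "C1 f (S \<union> T)"
  using assms unfolding C1_def by (auto intro: continuous_on_open_Un)

lemma C1_const [intro]: "C1 (\<lambda>x. c) S"
  by (rule C1I[where f' = "\<lambda>_ _. 0"]) auto

lemma C1_add [intro]:
  assumes "C1 f S" "C1 g S" shows "C1 (\<lambda>x. f x + g x) S"
  by (rule C1I[OF has_derivative_add[OF C1_has_derivative[OF assms(1)] C1_has_derivative[OF assms(2)]]])
     (auto intro!: continuous_intros C1_continuous_derivative assms)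

lemma C1_diff [intro]:
  assumes "C1 f S" "C1 g S" shows "C1 (\<lambda>x. f x - g x) S"
  by (rule C1I[OF has_derivative_diff[OF C1_has_derivative[OF assms(1)] C1_has_derivative[OF assms(2)]]])
     (auto intro!: continuous_intros C1_continuous_derivative assms)

lemma C1_bounded_bilinear:
  assumes "bounded_bilinear h" "C1 f S" "C1 g S" shows "C1 (\<lambda>x. h (f x) (g x)) S"
proof (rule C1I)
  interpret bounded_bilinear h by fact
  show "((\<lambda>x. h (f x) (g x)) has_derivative
      (\<lambda>v. h (f x) (frechet_derivative g (at x) v) + h (frechet_derivative f (at x) v) (g x))) (at x)"
    if "x \<in> S" for x
    by (rule FDERIV[OF C1_has_derivative[OF assms(2) that] C1_has_derivative[OF assms(3) that]])
  show "continuous_on S (\<lambda>x. h (f x) (frechet_derivative g (at x) v)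
      + h (frechet_derivative f (at x) v) (g x))" for v
    by (intro continuous_intros continuous_on C1_continuous_derivative C1_continuous_on assms)
qed

lemmas C1_mult [intro] =
  C1_bounded_bilinear[OF bounded_bilinear_mult[where 'a = real]]
lemmas C1_inner [intro] = C1_bounded_bilinear[OF bounded_bilinear_inner]
lemmas C1_scaleR [intro] = C1_bounded_bilinear[OF bounded_bilinear_scaleR]

lemma C1_sum [intro]:
  "(\<And>i. i \<in> I \<Longrightarrow> C1 (f i) S) \<Longrightarrow> C1 (\<lambda>x. \<Sum>i\<in>I. f i x) S"
  by (induction I rule: infinite_finite_induct) auto

lemma C1_prod [intro]:
  fixes f :: "'i \<Rightarrow> 'a::euclidean_space \<Rightarrow> real"
  shows "(\<And>i. i \<in> I \<Longrightarrow> C1 (f i) S) \<Longrightarrow> C1 (\<lambda>x. \<Prod>i\<in>I. f i x) S"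
  by (induction I rule: infinite_finite_induct) auto

lemma C1_compose_real:
  fixes f :: "'a::euclidean_space \<Rightarrow> real"
  assumes f: "C1 f S"
    and g: "\<And>x. x \<in> S \<Longrightarrow> (g has_real_derivative g' (f x)) (at (f x))"
    and g': "continuous_on (f ` S) g'"
  shows "C1 (\<lambda>x. g (f x)) S"
proof (rule C1I)
  show "((\<lambda>x. g (f x)) has_derivative (\<lambda>v. g' (f x) * frechet_derivative f (at x) v)) (at x)"
    if "x \<in> S" for x
    using has_derivative_compose[OF C1_has_derivative[OF f that]
        g[OF that, unfolded has_field_derivative_def]] .
  show "continuous_on S (\<lambda>x. g' (f x) * frechet_derivative f (at x) v)" for v
    by (intro continuous_intros C1_continuous_derivative f
        continuous_on_compose2[OF g' C1_continuous_on[OF f]]) auto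
qed

lemma linear_expand_Basis:
  fixes f :: "'a::euclidean_space \<Rightarrow> 'b::real_vector"
  assumes "linear f" shows "f v = (\<Sum>b\<in>Basis. (v \<bullet> b) *\<^sub>R f b)"
  by (subst euclidean_representation[of v, symmetric])
     (simp add: linear_sum[OF assms] linear_scale[OF assms])

lemma C1_compose:
  assumes f: "C1 f S" and g: "C1 g T" and sub: "f ` S \<subseteq> T"
  shows "C1 (\<lambda>x. g (f x)) S"
proof (rule C1I)
  show "((\<lambda>x. g (f x)) has_derivative
      (\<lambda>v. frechet_derivative g (at (f x)) (frechet_derivative f (at x) v))) (at x)"
    if "x \<in> S" for x
    using has_derivative_compose[OF C1_has_derivative[OF f that] C1_has_derivative[OF g]] that sub
    by blast
  have eq: "frechet_derivative g (at (f x)) w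
      = (\<Sum>b\<in>Basis. (w \<bullet> b) *\<^sub>R frechet_derivative g (at (f x)) b)"
    if "x \<in> S" for x w
    using that sub C1_has_derivative[OF g, of "f x"]
    by (intro linear_expand_Basis has_derivative_linear) auto
  have "continuous_on S (\<lambda>x. \<Sum>b\<in>Basis. (frechet_derivative f (at x) v \<bullet> b)
      *\<^sub>R frechet_derivative g (at (f x)) b)" for v
    using sub
    by (intro continuous_intros C1_continuous_derivative f
        continuous_on_compose2[OF C1_continuous_derivative[OF g] C1_continuous_on[OF f]]) auto
  then show "continuous_on S
      (\<lambda>x. frechet_derivative g (at (f x)) (frechet_derivative f (at x) v))" for v
    using eq by (subst continuous_on_cong[OF refl eq]) auto
qed

text \<open>
  \<open>U\<close> and the complement of \<open>K\<close> cover the whole space by open sets, and the extension is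
  continuously differentiable on both.
\<close>

lemma C1_extend_zero:
  assumes f: "C1 f U" and U: "open U" and K: "compact K" "K \<subseteq> U"
    and zero: "\<And>x. x \<in> U \<Longrightarrow> x \<notin> K \<Longrightarrow> f x = 0"
  shows "C1 (\<lambda>x. if x \<in> U then f x else 0) UNIV"
proof -
  have "C1 (\<lambda>x. if x \<in> U then f x else 0) (U \<union> - K)"
  proof (rule C1_union)
    show "C1 (\<lambda>x. if x \<in> U then f x else 0) U"
      by (rule C1_cong[OF f U]) simp
    show "C1 (\<lambda>x. if x \<in> U then f x else 0) (- K)"
      by (rule C1_cong[OF C1_const[of 0]])
         (use zero compact_imp_closed[OF K(1)] in auto)
  qed (use U compact_imp_closed[OF K(1)] in auto)
  moreover have "U \<union> - K = UNIV" using K(2) by auto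
  ultimately show ?thesis by simp
qed

lemma smooth_on_C1:
  fixes f :: "'a::euclidean_space \<Rightarrow> 'b::real_normed_vector"
  assumes "smooth_on f S" "open S"
  shows "C1 f S" "C1 (\<lambda>x. frechet_derivative f (at x) v) S"
proof -
  have *: "C1 h S" if "Ck_on 1 h S" for h :: "'a \<Rightarrow> 'b"
  proof -
    have d: "(h has_derivative frechet_derivative h (at x)) (at x)" if "x \<in> S" for x
      using \<open>Ck_on 1 h S\<close> that \<open>open S\<close>
      by (metis Ck_on.simps(2) One_nat_def differentiable_on_eq_differentiable_at
          frechet_derivative_works)
    show ?thesis
    proof (rule C1I[OF d])
      fix v
      have "continuous_on S (\<lambda>x. \<Sum>b\<in>Basis. (v \<bullet> b) *\<^sub>R frechet_derivative h (at x) b)"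
        using \<open>Ck_on 1 h S\<close> by (intro continuous_intros) simp
      then show "continuous_on S (\<lambda>x. frechet_derivative h (at x) v)"
        using linear_expand_Basis[OF has_derivative_linear[OF d], of _ v]
        by (simp cong: continuous_on_cong)
    qed
  qed
  have c1: "Ck_on 1 f S" and c2: "Ck_on 2 f S"
    using assms unfolding smooth_on_def by blast+
  show C: "C1 f S" by (rule *[OF c1])
  have "C1 (\<lambda>x. \<Sum>b\<in>Basis. (v \<bullet> b) *\<^sub>R frechet_derivative f (at x) b) S"
    using c2 * by (intro C1_sum C1_scaleR C1_const) (simp add: numeral_2_eq_2)
  then show "C1 (\<lambda>x. frechet_derivative f (at x) v) S"
    using linear_expand_Basis[OF has_derivative_linear[OF C1_has_derivative[OF C]], of _ v]
    by (rule C1_cong[OF _ assms(2)]) auto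
qed

text \<open>
  Two applications of the mean value theorem, first in the direction \<open>v\<close> to the difference in the
  direction \<open>w\<close>, then in the direction \<open>w\<close> to the derivative along \<open>v\<close>.
\<close>

lemma second_difference_mean_value:
  fixes f :: "'a::euclidean_space \<Rightarrow> real"
  assumes t: "0 < t"
    and sub: "\<And>s u. s \<in> {0..t} \<Longrightarrow> u \<in> {0..t} \<Longrightarrow> x + s *\<^sub>R v + u *\<^sub>R w \<in> S"
    and f: "\<And>y. y \<in> S \<Longrightarrow> (f has_derivative f' y) (at y)"
    and f'': "\<And>y. y \<in> S \<Longrightarrow> ((\<lambda>z. f' z v) has_derivative f'' y) (at y)"
  obtains s u where "s \<in> {0..t}" "u \<in> {0..t}"
    "f (x + t *\<^sub>R v + t *\<^sub>R w) - f (x + t *\<^sub>R v) - f (x + t *\<^sub>R w) + f x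
       = t * t * f'' (x + s *\<^sub>R v + u *\<^sub>R w) w"
proof -
  define p where "p s = f (x + s *\<^sub>R v + t *\<^sub>R w) - f (x + s *\<^sub>R v + 0 *\<^sub>R w)" for s
  have d: "((\<lambda>s. f (x + s *\<^sub>R v + c *\<^sub>R w)) has_real_derivative f' (x + s *\<^sub>R v + c *\<^sub>R w) v) (at s)"
    if "s \<in> {0..t}" "c \<in> {0..t}" for s c
  proof -
    have "((\<lambda>s. x + s *\<^sub>R v + c *\<^sub>R w) has_derivative (\<lambda>h. h *\<^sub>R v)) (at s)"
      by (auto intro!: derivative_eq_intros)
    from has_derivative_compose[OF this f[OF sub[OF that]]]
    have "((\<lambda>s. f (x + s *\<^sub>R v + c *\<^sub>R w)) has_derivative
        (\<lambda>h. f' (x + s *\<^sub>R v + c *\<^sub>R w) (h *\<^sub>R v))) (at s)" by simp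
    moreover have "linear (f' (x + s *\<^sub>R v + c *\<^sub>R w))"
      by (rule has_derivative_linear[OF f[OF sub[OF that]]])
    ultimately show ?thesis
      by (simp add: has_field_derivative_def linear_scale mult.commute[of _ "f' (x + s *\<^sub>R v + c *\<^sub>R w) v"])
  qed
  have "\<exists>s>0. s < t \<and> p t - p 0
      = (t - 0) * (f' (x + s *\<^sub>R v + t *\<^sub>R w) v - f' (x + s *\<^sub>R v + 0 *\<^sub>R w) v)"
    unfolding p_def by (rule MVT2[OF t]) (use t in \<open>intro derivative_intros d; auto\<close>)
  then obtain s where s: "0 < s" "s < t"
    "p t - p 0 = t * (f' (x + s *\<^sub>R v + t *\<^sub>R w) v - f' (x + s *\<^sub>R v + 0 *\<^sub>R w) v)" by auto
  have d2: "((\<lambda>u. f' (x + s *\<^sub>R v + u *\<^sub>R w) v) has_real_derivative f'' (x + s *\<^sub>R v + u *\<^sub>R w) w) (at u)"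
    if "u \<in> {0..t}" for u
  proof -
    have m: "x + s *\<^sub>R v + u *\<^sub>R w \<in> S" using s that by (intro sub) auto
    have "((\<lambda>u. x + s *\<^sub>R v + u *\<^sub>R w) has_derivative (\<lambda>h. h *\<^sub>R w)) (at u)"
      by (auto intro!: derivative_eq_intros)
    from has_derivative_compose[OF this f''[OF m]]
    have "((\<lambda>u. f' (x + s *\<^sub>R v + u *\<^sub>R w) v) has_derivative
        (\<lambda>h. f'' (x + s *\<^sub>R v + u *\<^sub>R w) (h *\<^sub>R w))) (at u)" by simp
    moreover have "linear (f'' (x + s *\<^sub>R v + u *\<^sub>R w))"
      by (rule has_derivative_linear[OF f''[OF m]])
    ultimately show ?thesis
      by (simp add: has_field_derivative_def linear_scale mult.commute[of _ "f'' (x + s *\<^sub>R v + u *\<^sub>R w) w"])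
  qed
  have "\<exists>u>0. u < t \<and> f' (x + s *\<^sub>R v + t *\<^sub>R w) v - f' (x + s *\<^sub>R v + 0 *\<^sub>R w) v
      = (t - 0) * f'' (x + s *\<^sub>R v + u *\<^sub>R w) w"
    by (rule MVT2[OF t]) (use d2 in auto)
  then obtain u where u: "0 < u" "u < t"
    "f' (x + s *\<^sub>R v + t *\<^sub>R w) v - f' (x + s *\<^sub>R v + 0 *\<^sub>R w) v
      = t * f'' (x + s *\<^sub>R v + u *\<^sub>R w) w" by auto
  show ?thesis
    by (rule that[of s u]) (use s u in \<open>auto simp: p_def algebra_simps\<close>)
qed

text \<open>
  The second difference over a parallelogram is symmetric in its two sides.  Divided by the product of
  the side lengths it equals both mixed derivatives at intermediate points, and these points tend to \<open>x\<close> as the parallelogram shrinks.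
\<close>

lemma second_derivative_symmetric:
  fixes f :: "'a::euclidean_space \<Rightarrow> real"
  assumes S: "open S" "x \<in> S" and f: "C1 f S"
    and fv: "C1 (\<lambda>y. frechet_derivative f (at y) v) S"
    and fw: "C1 (\<lambda>y. frechet_derivative f (at y) w) S"
  shows "frechet_derivative (\<lambda>y. frechet_derivative f (at y) v) (at x) w
       = frechet_derivative (\<lambda>y. frechet_derivative f (at y) w) (at x) v" (is "?P x = ?Q x")
proof -
  obtain r where r: "r > 0" "ball x r \<subseteq> S" using S openE by blast
  \<comment> \<open>side lengths so small that the parallelogram at x stays inside the ball\<close>
  define d where "d n = r / (norm v + norm w + 1) / real (Suc n + 1)" for n
  have d0: "d n > 0" for n using r by (auto simp: d_def add_nonneg_pos)
  have near: "x + s *\<^sub>R v + u *\<^sub>R w \<in> S" if "s \<in> {0..d n}" "u \<in> {0..d n}" for s u n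
  proof -
    have "norm (s *\<^sub>R v + u *\<^sub>R w) \<le> d n * norm v + d n * norm w"
      using that by (intro order_trans[OF norm_triangle_ineq] add_mono) (auto intro: mult_right_mono)
    also have "\<dots> = d n * (norm v + norm w)" by (simp add: algebra_simps)
    also have "\<dots> < d n * (norm v + norm w + 1)" using d0 by (intro mult_strict_left_mono) auto
    also have "\<dots> = r / real (Suc n + 1)"
    proof -
      have "norm v + norm w + 1 \<noteq> 0" by (smt (verit) norm_ge_zero)
      then show ?thesis unfolding d_def by simp
    qed
    also have "\<dots> \<le> r" using r by (simp add: divide_le_eq)
    finally have "x + s *\<^sub>R v + u *\<^sub>R w \<in> ball x r"
      by (subst mem_ball, subst dist_commute) (simp add: dist_norm add.assoc)
    then show ?thesis using r by auto
  qed
  have ex: "\<exists>s u s' u'. s \<in> {0..d n} \<and> u \<in> {0..d n} \<and> s' \<in> {0..d n} \<and> u' \<in> {0..d n} \<and>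
      ?P (x + s *\<^sub>R v + u *\<^sub>R w) = ?Q (x + s' *\<^sub>R v + u' *\<^sub>R w)" for n
  proof -
    obtain s u where su: "s \<in> {0..d n}" "u \<in> {0..d n}"
      "f (x + d n *\<^sub>R v + d n *\<^sub>R w) - f (x + d n *\<^sub>R v) - f (x + d n *\<^sub>R w) + f x
        = d n * d n * ?P (x + s *\<^sub>R v + u *\<^sub>R w)"
      by (rule second_difference_mean_value[OF d0 near C1_has_derivative[OF f] C1_has_derivative[OF fv]])
    obtain u' s' where su': "u' \<in> {0..d n}" "s' \<in> {0..d n}"
      "f (x + d n *\<^sub>R w + d n *\<^sub>R v) - f (x + d n *\<^sub>R w) - f (x + d n *\<^sub>R v) + f x
        = d n * d n * ?Q (x + u' *\<^sub>R w + s' *\<^sub>R v)"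
    proof (rule second_difference_mean_value[OF d0 _ C1_has_derivative[OF f] C1_has_derivative[OF fw]])
      show "x + s *\<^sub>R w + u *\<^sub>R v \<in> S" if "s \<in> {0..d n}" "u \<in> {0..d n}" for s u
        using near[OF that(2,1)] by (simp add: algebra_simps)
    qed
    have "d n * d n * ?P (x + s *\<^sub>R v + u *\<^sub>R w) = d n * d n * ?Q (x + u' *\<^sub>R w + s' *\<^sub>R v)"
      using su(3) su'(3) by (simp add: algebra_simps)
    then have "?P (x + s *\<^sub>R v + u *\<^sub>R w) = ?Q (x + s' *\<^sub>R v + u' *\<^sub>R w)"
      using d0[of n] by (simp add: algebra_simps)
    then show ?thesis using su su' by blast
  qed
  obtain s u s' u' where B: "s n \<in> {0..d n}" "u n \<in> {0..d n}" "s' n \<in> {0..d n}" "u' n \<in> {0..d n}"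
      and eq: "?P (x + s n *\<^sub>R v + u n *\<^sub>R w) = ?Q (x + s' n *\<^sub>R v + u' n *\<^sub>R w)" for n
    using ex by metis
  have "(\<lambda>n. r / (norm v + norm w + 1) / real (n + 2)) \<longlonglongrightarrow> 0"
    by (rule LIMSEQ_ignore_initial_segment[OF lim_const_over_n])
  then have "d \<longlonglongrightarrow> 0"
    unfolding d_def by (simp only: add_Suc_right add_Suc numeral_2_eq_2 add_0_right One_nat_def)
  have to0: "q \<longlonglongrightarrow> 0" if "\<And>n. q n \<in> {0..d n}" for q
  proof (rule tendsto_sandwich[OF _ _ tendsto_const \<open>d \<longlonglongrightarrow> 0\<close>])
    show "\<forall>\<^sub>F n in sequentially. 0 \<le> q n" "\<forall>\<^sub>F n in sequentially. q n \<le> d n"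
      using that by simp_all
  qed
  have lim: "(\<lambda>n. h (x + q n *\<^sub>R v + q' n *\<^sub>R w)) \<longlonglongrightarrow> h x"
    if "continuous_on S h" "\<And>n. q n \<in> {0..d n}" "\<And>n. q' n \<in> {0..d n}" for h :: "'a \<Rightarrow> real" and q q'
  proof -
    have "(\<lambda>n. x + q n *\<^sub>R v + q' n *\<^sub>R w) \<longlonglongrightarrow> x + 0 *\<^sub>R v + 0 *\<^sub>R w"
      by (intro tendsto_intros to0 that)
    then have "(\<lambda>n. x + q n *\<^sub>R v + q' n *\<^sub>R w) \<longlonglongrightarrow> x" by simp
    moreover have "isCont h x" using that(1) S continuous_on_eq_continuous_at by blast
    ultimately show ?thesis by (rule isCont_tendsto_compose[rotated])
  qed
  have "(\<lambda>n. ?P (x + s n *\<^sub>R v + u n *\<^sub>R w)) \<longlonglongrightarrow> ?P x"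
    by (rule lim[OF C1_continuous_derivative[OF fv] B(1,2)])
  moreover have "(\<lambda>n. ?Q (x + s' n *\<^sub>R v + u' n *\<^sub>R w)) \<longlonglongrightarrow> ?Q x"
    by (rule lim[OF C1_continuous_derivative[OF fw] B(3,4)])
  ultimately show ?thesis
    unfolding eq by (rule LIMSEQ_unique)
qed

text \<open>
  In the Leibniz formula a permutation other than the identity moves at least two indices, so after
  differentiating one factor another off-diagonal entry of the identity matrix remains.
\<close>

lemma has_derivative_det_at_id:
  fixes M :: "'a::real_normed_vector \<Rightarrow> real^'n^'n"
  assumes "\<And>i j. ((\<lambda>x. M x $ i $ j) has_derivative M' i j) (at x)" and "M x = mat 1"
  shows "((\<lambda>x. det (M x)) has_derivative (\<lambda>h. \<Sum>i\<in>UNIV. M' i i h)) (at x)"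
proof -
  let ?P = "{p. p permutes (UNIV :: 'n set)}"
  let ?t = "\<lambda>p h. of_int (sign p) * (\<Sum>i\<in>UNIV. M' i (p i) h * (\<Prod>j\<in>UNIV - {i}. M x $ j $ p j))"
  have "((\<lambda>x. \<Sum>p\<in>?P. of_int (sign p) * (\<Prod>i\<in>UNIV. M x $ i $ p i)) has_derivative
      (\<lambda>h. \<Sum>p\<in>?P. ?t p h)) (at x)"
    by (intro has_derivative_sum has_derivative_mult_right has_derivative_prod assms(1))
  moreover have "?t p h = 0" if p: "p \<in> ?P" "p \<noteq> id" for p h
  proof -
    have "(\<Prod>j\<in>UNIV - {i}. M x $ j $ p j) = 0" for i
    proof -
      obtain k where k: "p k \<noteq> k" using p(2) by (metis eq_id_iff)
      have "p (p k) \<noteq> p k" using k p(1) by (metis mem_Collect_eq permutes_inj_on inj_onD UNIV_I)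
      then obtain j where "j \<noteq> i" "p j \<noteq> j" using k by metis
      then show ?thesis
        by (intro prod_zero) (auto simp: assms(2) mat_def intro!: bexI[of _ j])
    qed
    then show ?thesis by (simp only: mult_zero_right sum.neutral_const)
  qed
  then have "(\<Sum>p\<in>?P. ?t p h) = ?t id h" for h
    by (subst sum.mono_neutral_right[where S = "{id}"]) (auto simp: permutes_id finite_permutations)
  moreover have "?t id h = (\<Sum>i\<in>UNIV. M' i i h)" for h
    by (simp add: assms(2) mat_def sign_id)
  ultimately show ?thesis by (simp add: det_def)
qed

lemma C1_det:
  assumes "\<And>i j. C1 (\<lambda>x. M x $ i $ j) S"
  shows "C1 (\<lambda>x. det (M x :: real^'n^'n)) S"
  unfolding det_def by (intro C1_sum C1_mult C1_prod C1_const assms)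

text \<open>
  The square makes this a continuously differentiable function that still vanishes on a half-line;
  cutoff and plateau functions are built from it.
\<close>

definition pos_square :: "real \<Rightarrow> real" where
  "pos_square t = (max 0 t)\<^sup>2"

lemma pos_square_derivative: "(pos_square has_real_derivative 2 * max 0 t) (at t)"
proof -
  consider "t > 0" | "t < 0" | "t = 0" by linarith
  then show ?thesis
  proof cases
    case 1
    have "((\<lambda>t. t\<^sup>2) has_real_derivative 2 * max 0 t) (at t)"
      using 1 by (auto intro!: derivative_eq_intros)
    then show ?thesis
      by (rule has_field_derivative_transform_within_open[of _ _ _ "{0<..}"])
         (use 1 in \<open>auto simp: pos_square_def\<close>)
  next
    case 2
    have "((\<lambda>t. 0) has_real_derivative 2 * max 0 t) (at t)"
      using 2 by (auto intro!: derivative_eq_intros)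
    then show ?thesis
      by (rule has_field_derivative_transform_within_open[of _ _ _ "{..<0}"])
         (use 2 in \<open>auto simp: pos_square_def\<close>)
  next
    case 3
    have "((\<lambda>h. (pos_square (0 + h) - pos_square 0) / h) \<longlongrightarrow> 0) (at 0)"
    proof (rule Lim_null_comparison[OF always_eventually])
      show "\<forall>h. norm ((pos_square (0 + h) - pos_square 0) / h) \<le> \<bar>h\<bar>"
        by (auto simp: pos_square_def max_def power2_eq_square)
      show "((\<lambda>h. \<bar>h :: real\<bar>) \<longlongrightarrow> 0) (at 0)"
        by (rule tendsto_eq_intros tendsto_rabs refl | simp)+
    qed
    then show ?thesis using 3 by (simp add: DERIV_def)
  qed
qed

lemma pos_square_simps:
  "t \<le> 0 \<Longrightarrow> pos_square t = 0" "t \<ge> 0 \<Longrightarrow> pos_square t = t\<^sup>2" "pos_square t \<ge> 0"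
  by (auto simp: pos_square_def)

lemma C1_pos_square: "C1 f S \<Longrightarrow> C1 (\<lambda>x. pos_square (f x)) S"
  by (rule C1_compose_real[where g' = "\<lambda>t. 2 * max 0 t"])
     (auto intro!: pos_square_derivative continuous_intros)

section \<open>Integration by parts and Gram determinants\<close>

text \<open>
  Lebesgue measure is translation invariant, so every difference quotient of \<open>F\<close> has integral zero;
  the mean value theorem bounds the quotients by a multiple of the indicator of a compact set, and
  dominated convergence passes to the limit.
\<close>

lemma has_integral_zero_directional_derivative:
  fixes F :: "'a::euclidean_space \<Rightarrow> real"
  assumes F: "C1 F UNIV" and K: "compact K" and zero: "\<And>x. x \<notin> K \<Longrightarrow> F x = 0"
  shows "has_bochner_integral lborel (\<lambda>x. frechet_derivative F (at x) v) 0"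
proof -
  let ?D = "\<lambda>x. frechet_derivative F (at x) v"
  have contF: "continuous_on UNIV F" by (rule C1_continuous_on[OF F])
  have contD: "continuous_on UNIV ?D" by (rule C1_continuous_derivative[OF F])
  have Dzero: "?D x = 0" if "x \<notin> K" for x
  proof -
    have "((\<lambda>_. 0) has_derivative frechet_derivative F (at x)) (at x)"
      by (rule has_derivative_transform_within_open[OF C1_has_derivative[OF F UNIV_I],
            of "- K"]) (use that zero compact_imp_closed[OF K] in auto)
    then have "frechet_derivative F (at x) = (\<lambda>_. 0)"
      using has_derivative_unique has_derivative_const by blast
    then show ?thesis by simp
  qed
  have "bounded (?D ` K)"
    by (intro compact_imp_bounded compact_continuous_image continuous_on_subset[OF contD] K) auto
  then obtain B where B: "\<And>x. x \<in> K \<Longrightarrow> \<bar>?D x\<bar> \<le> B" "0 < B"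
    unfolding bounded_pos by (auto simp: image_iff)
  then have B': "\<bar>?D x\<bar> \<le> B" for x
    using Dzero[of x] by (cases "x \<in> K") auto
  \<comment> \<open>all points from which a step of length at most 1 along v can reach K\<close>
  define K' where "K' = (\<lambda>(x, s). x - s *\<^sub>R v) ` (K \<times> {0..1})"
  have "compact K'"
    unfolding K'_def case_prod_beta
    by (intro compact_continuous_image continuous_intros compact_Times K compact_Icc)
  define t where "t n = 1 / real (Suc n)" for n
  have t: "0 < t n" "t n \<le> 1" for n by (auto simp: t_def)
  have t0: "t \<longlonglongrightarrow> 0" unfolding t_def by (rule LIMSEQ_Suc[OF lim_const_over_n])
  let ?q = "\<lambda>n x. (F (t n *\<^sub>R v + x) - F x) / t n"
  have along: "((\<lambda>s. F (s *\<^sub>R v + x)) has_real_derivative ?D (s *\<^sub>R v + x)) (at s)" for s x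
  proof -
    have "((\<lambda>s. s *\<^sub>R v + x) has_derivative (\<lambda>h. h *\<^sub>R v)) (at s)"
      by (auto intro!: derivative_eq_intros)
    from has_derivative_compose[OF this C1_has_derivative[OF F UNIV_I]]
    have "((\<lambda>s. F (s *\<^sub>R v + x)) has_derivative
        (\<lambda>h. frechet_derivative F (at (s *\<^sub>R v + x)) (h *\<^sub>R v))) (at s)" by simp
    moreover have "linear (frechet_derivative F (at (s *\<^sub>R v + x)))"
      by (rule has_derivative_linear[OF C1_has_derivative[OF F UNIV_I]])
    ultimately show ?thesis
      by (simp add: has_field_derivative_def linear_scale mult.commute[of _ "?D (s *\<^sub>R v + x)"])
  qed
  have qbound: "norm (?q n x) \<le> indicator K' x *\<^sub>R B" for n x
  proof (cases "x \<in> K'")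
    case True
    have "\<exists>s>0. s < t n \<and> F (t n *\<^sub>R v + x) - F (0 *\<^sub>R v + x) = (t n - 0) * ?D (s *\<^sub>R v + x)"
      by (rule MVT2[OF t(1)]) (rule along)
    then obtain s where "F (t n *\<^sub>R v + x) - F x = t n * ?D (s *\<^sub>R v + x)" by auto
    then show ?thesis using True B'[of "s *\<^sub>R v + x"] t[of n] by simp
  next
    case False
    have "x \<notin> K" using False unfolding K'_def by (force simp: image_iff)
    moreover have "t n *\<^sub>R v + x \<notin> K"
    proof
      assume "t n *\<^sub>R v + x \<in> K"
      then have "x \<in> K'" unfolding K'_def using t[of n]
        by (intro image_eqI[of _ _ "(t n *\<^sub>R v + x, t n)"]) auto
      with False show False ..
    qed
    ultimately show ?thesis using False zero by simp
  qed
  have lim: "(\<lambda>n. ?q n x) \<longlonglongrightarrow> ?D x" for x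
  proof -
    have "((\<lambda>h. (F (h *\<^sub>R v + x) - F x) / h) \<longlongrightarrow> ?D x) (at 0)"
      using along[of x 0] by (simp add: has_field_derivative_iff)
    moreover have "filterlim t (at 0) sequentially"
      using t0 t(1) by (intro filterlim_atI) (auto simp: less_imp_neq[OF t(1), symmetric] eventually_sequentially)
    ultimately show ?thesis by (rule filterlim_compose)
  qed
  have int: "integrable lborel F"
    using borel_integrable_compact[OF K continuous_on_subset[OF contF]] zero
    by (subst Bochner_Integration.integrable_cong[OF refl, where g = "\<lambda>x. indicator K x *\<^sub>R F x"]) (auto simp: indicator_def)
  have mF: "F \<in> borel_measurable borel"
    by (rule borel_measurable_continuous_onI[OF contF])
  have shift: "integrable lborel (\<lambda>x. F (c + x))" "(\<integral>x. F (c + x) \<partial>lborel) = integral\<^sup>L lborel F" for c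
  proof -
    have "integrable (distr lborel borel ((+) c)) F" using int by (simp add: lborel_distr_plus)
    then show "integrable lborel (\<lambda>x. F (c + x))"
      by (subst (asm) integrable_distr_eq) (auto simp: mF)
    have "(\<integral>x. F x \<partial>distr lborel borel ((+) c)) = (\<integral>x. F (c + x) \<partial>lborel)"
      by (intro integral_distr) (auto simp: mF)
    then show "(\<integral>x. F (c + x) \<partial>lborel) = integral\<^sup>L lborel F" by (simp add: lborel_distr_plus)
  qed
  have q0: "integral\<^sup>L lborel (?q n) = 0" for n
    using shift[of "t n *\<^sub>R v"] int by simp
  have ms: "\<And>n. ?q n \<in> borel_measurable lborel" 
    using shift int by (intro borel_measurable_divide borel_measurable_diff) auto
  have md: "?D \<in> borel_measurable lborel"
    using borel_measurable_continuous_onI[OF contD] by simp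
  have iw: "integrable lborel (\<lambda>x. indicator K' x *\<^sub>R B)"
    by (rule borel_integrable_compact[OF \<open>compact K'\<close>]) auto
  have "integrable lborel ?D"
    by (rule integrable_dominated_convergence[where s = ?q, OF md ms iw]) (use lim qbound in auto)
  moreover have "(\<lambda>n. integral\<^sup>L lborel (?q n)) \<longlonglongrightarrow> integral\<^sup>L lborel ?D"
    by (rule integral_dominated_convergence[where s = ?q, OF md ms iw]) (use lim qbound in auto)
  then have "integral\<^sup>L lborel ?D = 0"
    unfolding q0 by (simp add: LIMSEQ_const_iff)
  ultimately show ?thesis by (simp add: has_bochner_integral_iff)
qed

lemma ex_orthonormal_preimages:
  fixes L :: "real^'n \<Rightarrow> 'e::euclidean_space"
  assumes L: "linear L" "inj L"
  obtains e where "\<And>i j :: 'n. L (e i) \<bullet> L (e j) = (if i = j then 1 else 0)"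
proof -
  have "subspace (range L)" using L(1) linear_subspace_image subspace_UNIV by blast
  then obtain B where B: "B \<subseteq> range L" "pairwise orthogonal B" "\<And>x. x \<in> B \<Longrightarrow> norm x = 1"
    "independent B" "card B = dim (range L)" "span B = range L"
    using orthonormal_basis_subspace by metis
  have "dim (range L) = CARD('n)" using dim_image_eq[OF L(1), of UNIV] L(2) by simp
  then have "\<exists>f. bij_betw f (UNIV :: 'n set) B"
    using B(4,5) by (intro finite_same_card_bij) (auto intro: independent_imp_finite)
  then obtain f where f: "bij_betw f (UNIV :: 'n set) B" by blast
  have fB: "f i \<in> B" for i using f by (auto simp: bij_betw_def)
  then have "\<exists>e. \<forall>i. L (e i) = f i" using B(1) by (intro choice) (metis rangeE subsetD)
  then obtain e where e: "\<And>i. L (e i) = f i" by blast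
  have "L (e i) \<bullet> L (e j) = (if i = j then 1 else 0)" for i j
  proof (cases "i = j")
    case True
    then show ?thesis using B(3)[OF fB[of i]] by (simp add: e norm_eq_1)
  next
    case False
    then have "f i \<noteq> f j" using f by (auto simp: bij_betw_def inj_on_def)
    then show ?thesis using B(2) fB False by (auto simp: e pairwise_def orthogonal_def)
  qed
  then show ?thesis by (rule that)
qed

text \<open>
  \<open>n\<close> together with the vectors \<open>E i\<close> is an orthonormal basis of the whole space.  This is where
  codimension one enters.
\<close>

lemma orthonormal_complement_zero:
  fixes E :: "'n::finite \<Rightarrow> 'e::euclidean_space"
  assumes E: "\<And>i j. E i \<bullet> E j = (if i = j then 1 else 0)"
    and n: "n \<bullet> n = 1" "\<And>i. n \<bullet> E i = 0" and dim: "DIM('e) = CARD('n) + 1"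
    and z: "z \<bullet> n = 0" "\<And>i. z \<bullet> E i = 0"
  shows "z = 0"
proof -
  let ?S = "insert n (range E)"
  have inj: "inj E" using E by (intro injI) (metis zero_neq_one)
  have "n \<notin> range E" using n by auto
  then have "card ?S = DIM('e)"
    using card_image[OF inj] dim by simp
  moreover have "independent ?S"
  proof (rule pairwise_orthogonal_independent)
    show "pairwise orthogonal ?S"
      using E n by (auto simp: pairwise_def orthogonal_def inner_commute)
    show "0 \<notin> ?S" using E n(1) by (auto simp: image_iff) (metis inner_zero_left zero_neq_one)
  qed
  ultimately have "span ?S = UNIV"
    by (metis card_eq_dim dim_UNIV finite.insertI finite_imageI finite_class.finite_UNIV order_refl
        span_UNIV dim_span independent_imp_finite subset_UNIV top.extremum_uniqueI)
  then have "z \<in> span ?S" by simp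
  moreover have "orthogonal z x" if "x \<in> ?S" for x
    using that z by (auto simp: orthogonal_def)
  ultimately have "orthogonal z z" by (rule orthogonal_to_span)
  then show ?thesis by (simp add: orthogonal_def)
qed

definition gram :: "(real^'n \<Rightarrow> 'e::real_inner) \<Rightarrow> real^'n^'n" where
  "gram L = (\<chi> i j. L (axis i 1) \<bullet> L (axis j 1))"

lemma linear_axis_expand:
  fixes L :: "real^'n \<Rightarrow> 'e::real_vector"
  assumes "linear L" shows "L v = (\<Sum>i\<in>UNIV. v $ i *\<^sub>R L (axis i 1))"
  by (subst basis_expansion[of v, symmetric])
     (simp add: linear_sum[OF assms] linear_scale[OF assms] scalar_mult_eq_scaleR)

lemma gram_bilinear:
  assumes "linear L" shows "(gram L *v v) \<bullet> w = L v \<bullet> L w"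
  unfolding linear_axis_expand[OF assms, of v] linear_axis_expand[OF assms, of w]
  by (simp add: gram_def inner_vec_def matrix_vector_mult_def inner_sum_left inner_sum_right
        sum_distrib_left sum_distrib_right mult_ac inner_commute)

lemma gram_change_of_frame:
  fixes e :: "'n \<Rightarrow> real^'n"
  assumes "linear L"
  shows "(\<chi> i j. L (e i) \<bullet> L (e j)) = (\<chi> i. e i) ** gram L ** transpose (\<chi> i. e i)"
proof -
  have "(L (e i) \<bullet> L (e j)) = ((\<chi> i. e i) ** gram L ** transpose (\<chi> i. e i)) $ i $ j" for i j
    unfolding gram_bilinear[OF assms, symmetric]
    by (simp add: matrix_matrix_mult_def transpose_def inner_vec_def matrix_vector_mult_def
        gram_def sum_distrib_left sum_distrib_right inner_commute mult_ac)
  then show ?thesis by (simp add: vec_eq_iff)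
qed

text \<open>
  At a point where the frame \<open>e\<close> is orthonormal the left-hand matrix is the identity, so this reduces
  derivatives of the area density to derivatives of a determinant at the identity.
\<close>

lemma det_gram_change_of_frame:
  assumes "linear L"
  shows "det (\<chi> i j. L (e i) \<bullet> L (e j)) = (det (\<chi> i. e i))\<^sup>2 * det (gram L)"
  by (simp add: gram_change_of_frame[OF assms] det_mul power2_eq_square)

lemma det_gram_pos:
  fixes L :: "real^'n \<Rightarrow> 'e::euclidean_space"
  assumes "linear L" "inj L"
  shows "det (gram L) > 0"
proof -
  obtain e where e: "\<And>i j :: 'n. L (e i) \<bullet> L (e j) = (if i = j then 1 else 0)"
    using ex_orthonormal_preimages[OF assms] by blast
  have "(det (\<chi> i. e i))\<^sup>2 * det (gram L) = 1"
    unfolding det_gram_change_of_frame[OF assms(1), symmetric] e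
    by (simp add: mat_def[symmetric])
  then show ?thesis
    by (metis zero_le_power2 zero_less_mult_pos less_eq_real_def mult_zero_left zero_less_one)
qed

text \<open>
  With \<open>E\<close> the matrix of the frame, orthonormality says that the transpose of \<open>E\<close> is inverse to
  \<open>E ** gram L\<close>; the left-hand side is then the trace of a conjugate of \<open>T\<close>.
\<close>

lemma trace_orthonormal_frame:
  fixes L :: "real^'n \<Rightarrow> 'e::real_inner" and T :: "real^'n \<Rightarrow> real^'n"
  assumes L: "linear L" and T: "linear T"
    and e: "\<And>i j :: 'n. L (e i) \<bullet> L (e j) = (if i = j then 1 else 0)"
  shows "(\<Sum>i\<in>UNIV. L (T (e i)) \<bullet> L (e i)) = (\<Sum>i\<in>UNIV. T (axis i 1) $ i)"
proof -
  let ?E = "\<chi> i. e i" and ?T = "matrix T"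
  have "mat 1 = ?E ** gram L ** transpose ?E"
    by (subst gram_change_of_frame[OF L, symmetric]) (simp add: e mat_def)
  then have inv: "transpose ?E ** (?E ** gram L) = mat 1"
    by (metis matrix_left_right_inverse)
  have "(\<Sum>i\<in>UNIV. L (T (e i)) \<bullet> L (e i)) = trace (?E ** gram L ** ?T ** transpose ?E)"
  proof -
    have "L (T (e i)) \<bullet> L (e i) = (?E ** gram L ** ?T ** transpose ?E) $ i $ i" for i
    proof -
      have "L (T (e i)) \<bullet> L (e i) = e i \<bullet> (gram L *v (?T *v e i))"
        by (simp add: gram_bilinear[OF L] matrix_vector_mul(2)[OF T] inner_commute[of "e i"])
      also have "\<dots> = (?E ** (gram L ** (?T ** transpose ?E))) $ i $ i"
        by (simp add: inner_vec_def matrix_vector_mult_def matrix_matrix_mult_def transpose_def)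
      finally show ?thesis by (simp add: matrix_mul_assoc)
    qed
    then show ?thesis by (simp add: trace_def)
  qed
  also have "\<dots> = trace (transpose ?E ** (?E ** gram L) ** ?T)"
    by (subst trace_mul_sym) (simp add: matrix_mul_assoc)
  also have "\<dots> = (\<Sum>i\<in>UNIV. T (axis i 1) $ i)"
    by (simp add: inv trace_def matrix_def)
  finally show ?thesis .
qed

section \<open>The divergence theorem in one chart\<close>

text \<open>
  A hypersurface as seen in one chart: \<open>Y\<close> is the immersion and \<open>\<nu>\<close> the unit normal, both written in
  coordinates.
\<close>

locale parametrized_hypersurface =
  fixes U :: "(real^'n::finite) set" and Y \<nu> :: "real^'n \<Rightarrow> 'e::euclidean_space"
  assumes open_U: "open U"
    and C1_Y: "C1 Y U"
    and C1_dY: "\<And>v. C1 (\<lambda>x. frechet_derivative Y (at x) v) U"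
    and C1_\<nu>: "C1 \<nu> U"
    and inj_dY: "\<And>x. x \<in> U \<Longrightarrow> inj (frechet_derivative Y (at x))"
    and unit_\<nu>: "\<And>x. x \<in> U \<Longrightarrow> \<nu> x \<bullet> \<nu> x = 1"
    and normal_\<nu>: "\<And>x v. x \<in> U \<Longrightarrow> \<nu> x \<bullet> frechet_derivative Y (at x) v = 0"
    and codim_1: "DIM('e) = CARD('n) + 1"
begin

abbreviation dY :: "real^'n \<Rightarrow> real^'n \<Rightarrow> 'e" where
  "dY x \<equiv> frechet_derivative Y (at x)"

abbreviation d\<nu> :: "real^'n \<Rightarrow> real^'n \<Rightarrow> 'e" where
  "d\<nu> x \<equiv> frechet_derivative \<nu> (at x)"

definition area :: "real^'n \<Rightarrow> real" where
  "area x = sqrt (det (gram (dY x)))"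

text \<open>
  The coordinates of the gradient of \<open>|Y|\<^sup>2 / 4\<close>, whose image under \<open>dY\<close> is half of the tangential
  part of \<open>Y\<close>.  Cramer's rule makes its dependence on the point visibly differentiable.
\<close>

definition half_tangent :: "real^'n \<Rightarrow> real^'n" where
  "half_tangent x = (\<chi> k. det (\<chi> i j. if j = k then dY x (axis i 1) \<bullet> Y x / 2
     else gram (dY x) $ i $ j) / det (gram (dY x)))"

lemma linear_dY: "x \<in> U \<Longrightarrow> linear (dY x)"
  by (rule has_derivative_linear[OF C1_has_derivative[OF C1_Y]])

lemma det_pos: "x \<in> U \<Longrightarrow> det (gram (dY x)) > 0"
  by (intro det_gram_pos linear_dY inj_dY)

lemma det_nonzero: "x \<in> U \<Longrightarrow> det (gram (dY x)) \<noteq> 0"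
  using det_pos by force

text \<open>
  Both sides have the same inner products with the normal and with all tangent vectors.
\<close>

lemma dY_half_tangent:
  assumes x: "x \<in> U"
  shows "dY x (half_tangent x) = (1/2) *\<^sub>R (Y x - (Y x \<bullet> \<nu> x) *\<^sub>R \<nu> x)"
proof -
  obtain e where e: "\<And>i j :: 'n. dY x (e i) \<bullet> dY x (e j) = (if i = j then 1 else 0)"
    using ex_orthonormal_preimages[OF linear_dY[OF x] inj_dY[OF x]] by blast
  have sys: "gram (dY x) *v half_tangent x = (\<chi> i. dY x (axis i 1) \<bullet> Y x / 2)"
    using det_pos[OF x] by (subst cramer) (auto simp: half_tangent_def vec_eq_iff cong: if_cong)
  have tan: "dY x (half_tangent x) \<bullet> dY x w = Y x \<bullet> dY x w / 2" for w
  proof -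
    have "dY x (half_tangent x) \<bullet> dY x w = (\<Sum>i\<in>UNIV. w $ i * (dY x (axis i 1) \<bullet> Y x / 2))"
      unfolding gram_bilinear[OF linear_dY[OF x], symmetric] sys
      by (simp add: inner_vec_def mult.commute)
    also have "\<dots> = Y x \<bullet> dY x w / 2"
      unfolding linear_axis_expand[OF linear_dY[OF x], of w]
      by (simp add: inner_sum_right sum_divide_distrib inner_commute)
    finally show ?thesis .
  qed
  have "dY x (half_tangent x) - (1/2) *\<^sub>R (Y x - (Y x \<bullet> \<nu> x) *\<^sub>R \<nu> x) = 0"
  proof (rule orthonormal_complement_zero[OF e unit_\<nu>[OF x] _ codim_1])
    show "\<nu> x \<bullet> dY x (e i) = 0" for i by (rule normal_\<nu>[OF x])
    show "(dY x (half_tangent x) - (1/2) *\<^sub>R (Y x - (Y x \<bullet> \<nu> x) *\<^sub>R \<nu> x)) \<bullet> \<nu> x = 0"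
      using normal_\<nu>[OF x, of "half_tangent x"] unit_\<nu>[OF x]
      by (simp add: inner_diff_left inner_diff_right inner_commute)
    show "(dY x (half_tangent x) - (1/2) *\<^sub>R (Y x - (Y x \<bullet> \<nu> x) *\<^sub>R \<nu> x)) \<bullet> dY x (e i) = 0" for i
      using normal_\<nu>[OF x, of "e i"] by (simp add: inner_diff_left tan)
  qed
  then show ?thesis by simp
qed

lemma C1_gram: "C1 (\<lambda>x. gram (dY x) $ i $ j) U"
  by (simp add: gram_def C1_inner C1_dY)

lemma C1_det_gram: "C1 (\<lambda>x. det (gram (dY x))) U"
  by (rule C1_det[OF C1_gram])

lemma C1_area: "C1 area U"
proof -
  have "C1 (\<lambda>x. sqrt (det (gram (dY x)))) U"
    by (rule C1_compose_real[OF C1_det_gram, where g' = "\<lambda>y. inverse (sqrt y) / 2"])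
       (auto intro!: DERIV_real_sqrt continuous_intros dest: det_pos)
  then show ?thesis by (simp add: area_def[abs_def])
qed

lemma area_pos: "x \<in> U \<Longrightarrow> area x > 0"
  by (simp add: area_def det_pos)

lemma C1_half_tangent: "C1 (\<lambda>x. half_tangent x $ k) U"
proof -
  have "C1 (\<lambda>x. det (\<chi> i j. if j = k then dY x (axis i 1) \<bullet> Y x / 2 else gram (dY x) $ i $ j)) U"
  proof (rule C1_det)
    fix i j
    have "C1 (\<lambda>x. (dY x (axis i 1) \<bullet> Y x) * (1/2)) U"
      by (intro C1_mult C1_inner C1_dY C1_Y C1_const)
    then show "C1 (\<lambda>x. (\<chi> i j. if j = k then dY x (axis i 1) \<bullet> Y x / 2
        else gram (dY x) $ i $ j) $ i $ j) U"
      using C1_gram by (cases "j = k") simp_all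
  qed
  moreover have "C1 (\<lambda>x. inverse (det (gram (dY x)))) U"
    by (rule C1_compose_real[OF C1_det_gram, where g' = "\<lambda>y. - (inverse y ^ Suc (Suc 0))"])
       (auto intro!: DERIV_inverse continuous_intros simp: det_nonzero simp del: power_Suc)
  ultimately show ?thesis
    unfolding half_tangent_def vec_lambda_beta divide_inverse by (rule C1_mult)
qed

text \<open>
  The derivative of \<open>half_tangent\<close>, assembled from its components.
\<close>

abbreviation da :: "real^'n \<Rightarrow> real^'n \<Rightarrow> real^'n" where
  "da x v \<equiv> (\<chi> k. frechet_derivative (\<lambda>y. half_tangent y $ k) (at x) v)"

abbreviation d2Y :: "real^'n \<Rightarrow> real^'n \<Rightarrow> real^'n \<Rightarrow> 'e" where
  "d2Y x v \<equiv> frechet_derivative (\<lambda>y. dY y v) (at x)"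

lemma second_derivative_commute:
  assumes x: "x \<in> U" shows "d2Y x v w = d2Y x w v"
proof (rule euclidean_eqI)
  fix b :: 'e
  have eq: "frechet_derivative (\<lambda>y. f y \<bullet> b) (at y) = (\<lambda>v. frechet_derivative f (at y) v \<bullet> b)"
    if "C1 f U" "y \<in> U" for f :: "real^'n \<Rightarrow> 'e" and y
    using frechet_derivative_at[OF has_derivative_inner_left[OF C1_has_derivative[OF that], of b]]
    by simp
  have "frechet_derivative (\<lambda>y. frechet_derivative (\<lambda>y. Y y \<bullet> b) (at y) v) (at x) w = d2Y x v w \<bullet> b"
    (is "frechet_derivative ?f _ _ = _") for v w
  proof -
    have "(?f has_derivative (\<lambda>w. d2Y x v w \<bullet> b)) (at x)"
      by (rule has_derivative_transform_within_open[OF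
          has_derivative_inner_left[OF C1_has_derivative[OF C1_dY x]] open_U x])
         (simp add: eq[OF C1_Y])
    from frechet_derivative_at[OF this, symmetric] show ?thesis by simp
  qed
  moreover have "C1 (\<lambda>y. frechet_derivative (\<lambda>y. Y y \<bullet> b) (at y) v) U" for v
    by (rule C1_cong[OF C1_inner[OF C1_dY C1_const] open_U]) (simp add: eq[OF C1_Y])
  moreover have "C1 (\<lambda>y. Y y \<bullet> b) U" by (intro C1_inner C1_Y C1_const)
  ultimately show "d2Y x v w \<bullet> b = d2Y x w v \<bullet> b"
    using second_derivative_symmetric[OF open_U x] by metis
qed

text \<open>
  The derivative along \<open>v\<close> of the equation \<open>dY_half_tangent\<close>, paired with \<open>dY x v\<close>.  Symmetry of the
  second derivative turns \<open>d2Y\<close> along \<open>v\<close> into a derivative along \<open>half_tangent x\<close>.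
\<close>

lemma derivative_tangential_position:
  assumes x: "x \<in> U"
  shows "dY x (da x v) \<bullet> dY x v + d2Y x v (half_tangent x) \<bullet> dY x v
    = (dY x v \<bullet> dY x v - (Y x \<bullet> \<nu> x) * (d\<nu> x v \<bullet> dY x v)) / 2"
proof -
  note Y' = C1_has_derivative[OF C1_Y x] and \<nu>' = C1_has_derivative[OF C1_\<nu> x]
  let ?a = half_tangent
  have "((\<lambda>y. \<Sum>k\<in>UNIV. ?a y $ k *\<^sub>R dY y (axis k 1)) has_derivative
      (\<lambda>v. \<Sum>k\<in>UNIV. ?a x $ k *\<^sub>R d2Y x (axis k 1) v + (da x v $ k) *\<^sub>R dY x (axis k 1))) (at x)"
    unfolding vec_lambda_beta
    by (intro has_derivative_sum has_derivative_scaleR C1_has_derivative[OF C1_half_tangent x]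
        C1_has_derivative[OF C1_dY x])
  moreover have "(\<Sum>k\<in>UNIV. ?a x $ k *\<^sub>R d2Y x (axis k 1) v + (da x v $ k) *\<^sub>R dY x (axis k 1))
      = d2Y x v (?a x) + dY x (da x v)" for v
    unfolding sum.distrib
      linear_axis_expand[OF linear_dY[OF x], of "da x v"]
      linear_axis_expand[OF has_derivative_linear[OF C1_has_derivative[OF C1_dY x]], of _ "?a x"]
    by (simp add: second_derivative_commute[OF x, of v])
  ultimately have L: "((\<lambda>y. \<Sum>k\<in>UNIV. ?a y $ k *\<^sub>R dY y (axis k 1)) has_derivative
      (\<lambda>v. d2Y x v (?a x) + dY x (da x v))) (at x)" by simp
  have "((\<lambda>y. (1/2) *\<^sub>R (Y y - (Y y \<bullet> \<nu> y) *\<^sub>R \<nu> y)) has_derivative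
      (\<lambda>v. (1/2) *\<^sub>R (dY x v - ((Y x \<bullet> \<nu> x) *\<^sub>R d\<nu> x v
        + (Y x \<bullet> d\<nu> x v + dY x v \<bullet> \<nu> x) *\<^sub>R \<nu> x)))) (at x)"
    by (intro has_derivative_scaleR_right has_derivative_diff Y' has_derivative_scaleR
        has_derivative_inner \<nu>')
  moreover have "(1/2) *\<^sub>R (Y y - (Y y \<bullet> \<nu> y) *\<^sub>R \<nu> y) = (\<Sum>k\<in>UNIV. ?a y $ k *\<^sub>R dY y (axis k 1))"
    if "y \<in> U" for y
    using dY_half_tangent[OF that] linear_axis_expand[OF linear_dY[OF that], of "?a y"] by simp
  ultimately have R: "((\<lambda>y. \<Sum>k\<in>UNIV. ?a y $ k *\<^sub>R dY y (axis k 1)) has_derivative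
      (\<lambda>v. (1/2) *\<^sub>R (dY x v - ((Y x \<bullet> \<nu> x) *\<^sub>R d\<nu> x v
        + (Y x \<bullet> d\<nu> x v + dY x v \<bullet> \<nu> x) *\<^sub>R \<nu> x)))) (at x)"
    by (rule has_derivative_transform_within_open[OF _ open_U x])
  have "d2Y x v (?a x) + dY x (da x v) = (1/2) *\<^sub>R (dY x v - ((Y x \<bullet> \<nu> x) *\<^sub>R d\<nu> x v
        + (Y x \<bullet> d\<nu> x v + dY x v \<bullet> \<nu> x) *\<^sub>R \<nu> x))"
    using has_derivative_unique[OF L R] by (rule fun_cong)
  from arg_cong[OF this, of "\<lambda>u. u \<bullet> dY x v"] show ?thesis
    using normal_\<nu>[OF x, of v]
    by (simp add: inner_add_left inner_diff_left algebra_simps)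
qed

text \<open>
  Jacobi's formula for the derivative of a determinant, in a frame that is orthonormal at \<open>x\<close>.
\<close>

lemma derivative_area:
  assumes x: "x \<in> U"
    and e: "\<And>i j :: 'n. dY x (e i) \<bullet> dY x (e j) = (if i = j then 1 else 0)"
  shows "frechet_derivative area (at x) v = area x * (\<Sum>i\<in>UNIV. d2Y x (e i) v \<bullet> dY x (e i))"
proof -
  let ?M = "\<lambda>y. \<chi> i j. dY y (e i) \<bullet> dY y (e j)" and ?E = "\<chi> i. e i"
  have Mx: "?M x = mat 1" by (simp add: e mat_def)
  have "((\<lambda>y. det (?M y)) has_derivative
      (\<lambda>v. \<Sum>i\<in>UNIV. dY x (e i) \<bullet> d2Y x (e i) v + d2Y x (e i) v \<bullet> dY x (e i))) (at x)"
    by (rule has_derivative_det_at_id[where M = ?M and M' = "\<lambda>i j v. dY x (e i) \<bullet> d2Y x (e j) v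
        + d2Y x (e i) v \<bullet> dY x (e j)"])
       (simp, intro has_derivative_inner C1_has_derivative[OF C1_dY x], rule Mx)
  then have M': "((\<lambda>y. det (?M y)) has_derivative
      (\<lambda>v. 2 * (\<Sum>i\<in>UNIV. d2Y x (e i) v \<bullet> dY x (e i)))) (at x)"
    by (simp add: inner_commute sum_distrib_left)
  have chg: "det (gram (dY y)) = det (gram (dY x)) * det (?M y)" if "y \<in> U" for y
  proof -
    have "(det ?E)\<^sup>2 * det (gram (dY x)) = 1"
      using det_gram_change_of_frame[OF linear_dY[OF x], of e] by (simp add: Mx)
    then show ?thesis
      using det_gram_change_of_frame[OF linear_dY[OF that], of e] by (simp add: algebra_simps)
  qed
  have pos: "det (gram (dY x)) * det (?M x) > 0"
    using det_pos[OF x] by (simp add: Mx)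
  let ?G = "det (gram (dY x))" and ?S = "\<lambda>v. \<Sum>i\<in>UNIV. d2Y x (e i) v \<bullet> dY x (e i)"
  have "((\<lambda>y. sqrt (?G * det (?M y))) has_derivative
      (\<lambda>v. inverse (sqrt (?G * det (?M x))) / 2 * (?G * (2 * ?S v)))) (at x)"
    by (rule has_derivative_compose[OF has_derivative_mult_right[OF M']
        DERIV_real_sqrt[OF pos, unfolded has_field_derivative_def]])
  then have "(area has_derivative
      (\<lambda>v. inverse (sqrt (?G * det (?M x))) / 2 * (?G * (2 * ?S v)))) (at x)"
    by (rule has_derivative_transform_within_open[OF _ open_U x]) (simp add: area_def chg)
  from frechet_derivative_at[OF this, symmetric]
  have "frechet_derivative area (at x) v = inverse (sqrt ?G) / 2 * (?G * (2 * ?S v))"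
    by (simp add: Mx)
  also have "\<dots> = sqrt ?G * ?S v"
    using det_pos[OF x] real_div_sqrt[of ?G] by (simp add: field_simps)
  finally show ?thesis by (simp add: area_def)
qed

text \<open>
  The formula \<open>\<Delta>(|Y|\<^sup>2/4) = (n + H \<langle>Y, \<nu>\<rangle>) / 2\<close>, multiplied by the area density; on the left the
  coordinate divergence of \<open>area\<close> times the gradient is expanded by the product rule.  The sum of
  \<open>derivative_tangential_position\<close> over an orthonormal frame produces the coordinate divergence of
  \<open>half_tangent\<close> and exactly the terms of \<open>derivative_area\<close>.
\<close>

lemma divergence_half_tangent:
  assumes x: "x \<in> U"
    and e: "\<And>i j :: 'n. dY x (e i) \<bullet> dY x (e j) = (if i = j then 1 else 0)"
  shows "frechet_derivative area (at x) (half_tangent x) + area x * (\<Sum>i\<in>UNIV. da x (axis i 1) $ i)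
    = area x * ((real CARD('n) + (Y x \<bullet> \<nu> x) * (\<Sum>i\<in>UNIV. - (d\<nu> x (e i) \<bullet> dY x (e i)))) / 2)"
proof -
  have lin: "linear (da x)"
    by (rule linearI) (auto simp: vec_eq_iff
        linear_add[OF has_derivative_linear[OF C1_has_derivative[OF C1_half_tangent x]]]
        linear_scale[OF has_derivative_linear[OF C1_has_derivative[OF C1_half_tangent x]]])
  have "(\<Sum>i\<in>UNIV. d2Y x (e i) (half_tangent x) \<bullet> dY x (e i)) + (\<Sum>i\<in>UNIV. da x (axis i 1) $ i)
      = (\<Sum>i\<in>UNIV. dY x (da x (e i)) \<bullet> dY x (e i) + d2Y x (e i) (half_tangent x) \<bullet> dY x (e i))"
    unfolding trace_orthonormal_frame[OF linear_dY[OF x] lin e, symmetric] sum.distrib by simp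
  also have "\<dots> = (\<Sum>i\<in>UNIV. (1 + (Y x \<bullet> \<nu> x) * - (d\<nu> x (e i) \<bullet> dY x (e i))) / 2)"
    by (simp add: derivative_tangential_position[OF x] e)
  also have "\<dots> = (real CARD('n) + (Y x \<bullet> \<nu> x) * (\<Sum>i\<in>UNIV. - (d\<nu> x (e i) \<bullet> dY x (e i)))) / 2"
    by (simp add: sum_divide_distrib[symmetric] sum_subtractf sum_negf sum_distrib_left)
  finally show ?thesis
    by (simp add: derivative_area[OF x e] distrib_left[symmetric])
qed

text \<open>
  \<open>h\<close> is the mean curvature; the frame in which it is computed may vary with the point in any way,
  since only its value at each single point matters.
\<close>

lemma local_divergence_theorem:
  assumes \<phi>: "C1 \<phi> U" and K: "compact K" "K \<subseteq> U" and zero: "\<And>x. x \<in> U \<Longrightarrow> x \<notin> K \<Longrightarrow> \<phi> x = 0"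
    and h: "\<And>x. x \<in> U \<Longrightarrow> \<exists>e. (\<forall>i j :: 'n. dY x (e i) \<bullet> dY x (e j) = (if i = j then 1 else 0)) \<and>
       h x = (\<Sum>i\<in>UNIV. - (d\<nu> x (e i) \<bullet> dY x (e i)))"
  shows "has_bochner_integral lborel (\<lambda>x. indicator U x * (area x *
     (frechet_derivative \<phi> (at x) (half_tangent x)
       + \<phi> x * ((real CARD('n) + (Y x \<bullet> \<nu> x) * h x) / 2)))) 0"
proof -
  let ?v = "\<lambda>k x. \<phi> x * (area x * half_tangent x $ k)"
  let ?F = "\<lambda>k x. if x \<in> U then ?v k x else 0"
  have C1v: "C1 (?v k) U" for k
    by (intro C1_mult \<phi> C1_area C1_half_tangent)
  have C1F: "C1 (?F k) UNIV" for k
    by (rule C1_extend_zero[OF C1v open_U K]) (simp add: zero)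
  have F0: "?F k x = 0" if "x \<notin> K" for k x
    using zero that by auto
  have "has_bochner_integral lborel
      (\<lambda>x. \<Sum>k\<in>UNIV. frechet_derivative (?F k) (at x) (axis k 1)) (\<Sum>k\<in>(UNIV :: 'n set). 0)"
    by (intro has_bochner_integral_sum has_integral_zero_directional_derivative[OF C1F K(1) F0])
  moreover have "(\<Sum>k\<in>UNIV. frechet_derivative (?F k) (at x) (axis k 1)) =
      indicator U x * (area x * (frechet_derivative \<phi> (at x) (half_tangent x)
       + \<phi> x * ((real CARD('n) + (Y x \<bullet> \<nu> x) * h x) / 2)))" for x
  proof (cases "x \<in> U")
    case True
    obtain e where e: "\<And>i j :: 'n. dY x (e i) \<bullet> dY x (e j) = (if i = j then 1 else 0)"
      "h x = (\<Sum>i\<in>UNIV. - (d\<nu> x (e i) \<bullet> dY x (e i)))" using h[OF True] by blast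
    let ?d\<phi> = "frechet_derivative \<phi> (at x)" and ?dw = "frechet_derivative area (at x)"
    have lin: "linear ?d\<phi>" "linear ?dw"
      using C1_has_derivative[OF \<phi> True] C1_has_derivative[OF C1_area True]
      by (auto intro: has_derivative_linear)
    have "(?F k has_derivative (\<lambda>v. \<phi> x * (area x * da x v $ k + ?dw v * half_tangent x $ k)
        + ?d\<phi> v * (area x * half_tangent x $ k))) (at x)" for k
    proof (rule has_derivative_transform_within_open[OF _ open_U True])
      show "(?v k has_derivative (\<lambda>v. \<phi> x * (area x * da x v $ k + ?dw v * half_tangent x $ k)
          + ?d\<phi> v * (area x * half_tangent x $ k))) (at x)"
        unfolding vec_lambda_beta
        by (intro has_derivative_mult C1_has_derivative[OF _ True] \<phi> C1_area C1_half_tangent)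
    qed simp
    from frechet_derivative_at[OF this, symmetric]
    have "frechet_derivative (?F k) (at x) v = \<phi> x * (area x * da x v $ k + ?dw v * half_tangent x $ k)
        + ?d\<phi> v * (area x * half_tangent x $ k)" for k v
      by simp
    then have "(\<Sum>k\<in>UNIV. frechet_derivative (?F k) (at x) (axis k 1))
      = (\<Sum>k\<in>UNIV. \<phi> x * (area x * da x (axis k 1) $ k + ?dw (axis k 1) * half_tangent x $ k)
        + ?d\<phi> (axis k 1) * (area x * half_tangent x $ k))" by simp
    also have "\<dots> = \<phi> x * (?dw (half_tangent x) + area x * (\<Sum>k\<in>UNIV. da x (axis k 1) $ k))
        + area x * ?d\<phi> (half_tangent x)"
      unfolding linear_axis_expand[OF lin(1), of "half_tangent x"]
        linear_axis_expand[OF lin(2), of "half_tangent x"]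
      by (simp add: sum.distrib sum_distrib_left algebra_simps)
    also have "\<dots> = indicator U x * (area x * (?d\<phi> (half_tangent x)
       + \<phi> x * ((real CARD('n) + (Y x \<bullet> \<nu> x) * h x) / 2)))"
      unfolding divergence_half_tangent[OF True e(1)] using True by (simp add: e(2) algebra_simps)
    finally show ?thesis .
  next
    case False
    have "frechet_derivative (?F k) (at x) = (\<lambda>_. 0)" for k
    proof -
      have "(?F k has_derivative (\<lambda>_. 0)) (at x)"
        by (rule has_derivative_transform_within_open[OF has_derivative_const[of 0], of "- K"])
           (use False K F0 compact_imp_closed[OF K(1)] in auto)
      then show ?thesis by (rule frechet_derivative_at[symmetric])
    qed
    then show ?thesis using False by simp
  qed
  ultimately show ?thesis by simp
qed

end

section \<open>Continuously differentiable functions on a manifold\<close>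

definition C1_fun :: "('m, 'n::finite) chart set \<Rightarrow> ('m \<Rightarrow> 'b::real_normed_vector) \<Rightarrow> bool" where
  "C1_fun A f \<longleftrightarrow> (\<forall>c\<in>A. C1 (f \<circ> chart_inv c) (snd c ` fst c))"

lemma C1_fun_add: "C1_fun A f \<Longrightarrow> C1_fun A g \<Longrightarrow> C1_fun A (\<lambda>p. f p + g p)"
  by (simp add: C1_fun_def o_def C1_add)

lemma C1_fun_diff: "C1_fun A f \<Longrightarrow> C1_fun A g \<Longrightarrow> C1_fun A (\<lambda>p. f p - g p)"
  by (simp add: C1_fun_def o_def C1_diff)

lemma C1_fun_mult:
  fixes f g :: "'m \<Rightarrow> real"
  shows "C1_fun A f \<Longrightarrow> C1_fun A g \<Longrightarrow> C1_fun A (\<lambda>p. f p * g p)"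
  by (simp add: C1_fun_def o_def C1_mult)

lemma C1_fun_inner:
  fixes f g :: "'m \<Rightarrow> 'b::real_inner"
  shows "C1_fun A f \<Longrightarrow> C1_fun A g \<Longrightarrow> C1_fun A (\<lambda>p. f p \<bullet> g p)"
  by (simp add: C1_fun_def o_def C1_inner)

lemma C1_fun_const: "C1_fun A (\<lambda>p. k)"
  by (simp add: C1_fun_def o_def C1_const)

lemma C1_fun_compose_real:
  fixes f :: "'m \<Rightarrow> real"
  assumes "C1_fun A f" "\<And>y. (g has_real_derivative g' y) (at y)" "continuous_on UNIV g'"
  shows "C1_fun A (\<lambda>p. g (f p))"
  unfolding C1_fun_def o_def
proof
  fix c assume "c \<in> A"
  then have f: "C1 (\<lambda>x. f (chart_inv c x)) (snd c ` fst c)"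
    using assms(1) by (auto simp: C1_fun_def o_def)
  show "C1 (\<lambda>x. g (f (chart_inv c x))) (snd c ` fst c)"
    by (rule C1_compose_real[OF f assms(2) continuous_on_subset[OF assms(3)]]) auto
qed

locale manifold =
  fixes A :: "('m::{t2_space, second_countable_topology}, 'n::finite) chart set"
  assumes atlas: "smooth_atlas A"
begin

lemma chart_cases: obtains c where "c \<in> A" "p \<in> fst c"
  using atlas unfolding smooth_atlas_def by (metis UN_E UNIV_I)

context
  fixes c assumes c: "c \<in> A"
begin

lemma open_dom: "open (fst c)" and open_img: "open (snd c ` fst c)"
  and chart_homeo: "homeomorphism (fst c) (snd c ` fst c) (snd c) (chart_inv c)"
  using atlas c unfolding smooth_atlas_def by blast+

lemma chart_inv_left [simp]: "p \<in> fst c \<Longrightarrow> chart_inv c (snd c p) = p"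
  using chart_homeo by (simp add: homeomorphism_apply1)

lemma chart_inv_right [simp]: "x \<in> snd c ` fst c \<Longrightarrow> snd c (chart_inv c x) = x"
  using chart_homeo by (simp add: homeomorphism_apply2)

lemma chart_inv_mem: "x \<in> snd c ` fst c \<Longrightarrow> chart_inv c x \<in> fst c"
  using chart_homeo by (metis homeomorphism_image2 imageI)

lemma continuous_chart: "continuous_on (fst c) (snd c)"
  and continuous_chart_inv: "continuous_on (snd c ` fst c) (chart_inv c)"
  using chart_homeo by (simp_all add: homeomorphism_def)

lemma chart_image_eq: "B \<subseteq> fst c \<Longrightarrow> snd c ` B = {x \<in> snd c ` fst c. chart_inv c x \<in> B}"
  by force

lemma open_chart_image: "open B \<Longrightarrow> open (snd c ` (fst c \<inter> B))"
  using continuous_chart_inv open_img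
  by (subst chart_image_eq) (auto simp: continuous_on_open_vimage Int_def vimage_def conj_commute
      chart_inv_mem cong: conj_cong)

end

lemma C1_transition:
  assumes "c \<in> A" "d \<in> A"
  shows "C1 (snd d \<circ> chart_inv c) (snd c ` (fst c \<inter> fst d))"
  using atlas assms open_chart_image[OF assms(1) open_dom[OF assms(2)]]
  by (intro smooth_on_C1) (auto simp: smooth_atlas_def)

text \<open>
  The chain rule for the transition map.  The statement is duplicated because the map \<open>T\<close> has to be
  the same for vector-valued and for real-valued functions.
\<close>

lemma chart_deriv_transition:
  assumes c: "c \<in> A" and d: "d \<in> A" and p: "p \<in> fst c" "p \<in> fst d"
  obtains T where "\<And>f v. C1_fun A f \<Longrightarrow>
    chart_deriv c (f :: 'm \<Rightarrow> 'b::real_normed_vector) p v = chart_deriv d f p (T v)"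
    and "\<And>f v. C1_fun A f \<Longrightarrow>
    chart_deriv c (f :: 'm \<Rightarrow> real) p v = chart_deriv d f p (T v)"
proof -
  let ?S = "snd c ` (fst c \<inter> fst d)"
  let ?\<tau> = "snd d \<circ> chart_inv c"
  let ?T = "frechet_derivative ?\<tau> (at (snd c p))"
  have S: "open ?S" "snd c p \<in> ?S" using open_chart_image[OF c open_dom[OF d]] p by auto
  have \<tau>': "(?\<tau> has_derivative ?T) (at (snd c p))"
    by (rule C1_has_derivative[OF C1_transition[OF c d] S(2)])
  have *: "frechet_derivative (f \<circ> chart_inv c) (at (snd c p)) v
     = frechet_derivative (f \<circ> chart_inv d) (at (snd d p)) (?T v)"
    if "C1_fun A f" for f :: "'m \<Rightarrow> 'x::real_normed_vector" and v
  proof -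
    have f: "C1 (f \<circ> chart_inv d) (snd d ` fst d)" using that d by (simp add: C1_fun_def)
    have \<tau>p: "?\<tau> (snd c p) = snd d p" using p c by simp
    have "((\<lambda>x. (f \<circ> chart_inv d) (?\<tau> x)) has_derivative
        (\<lambda>v. frechet_derivative (f \<circ> chart_inv d) (at (?\<tau> (snd c p))) (?T v))) (at (snd c p))"
      by (rule has_derivative_compose[OF \<tau>' C1_has_derivative[OF f]]) (use p \<tau>p in auto)
    then have "((f \<circ> chart_inv c) has_derivative
        (\<lambda>v. frechet_derivative (f \<circ> chart_inv d) (at (?\<tau> (snd c p))) (?T v))) (at (snd c p))"
      by (rule has_derivative_transform_within_open[OF _ S]) (use c d in auto)
    from frechet_derivative_at[OF this, symmetric] show ?thesis unfolding \<tau>p by simp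
  qed
  show ?thesis
    by (rule that[of ?T]) (auto simp: chart_deriv_def *)
qed

lemma C1_fun_continuous:
  assumes "C1_fun A f" shows "continuous_on UNIV f"
proof -
  have "\<exists>S. open S \<and> p \<in> S \<and> continuous_on S f" for p
  proof -
    obtain c where c: "c \<in> A" "p \<in> fst c" by (rule chart_cases)
    have "continuous_on (snd c ` fst c) (f \<circ> chart_inv c)"
      using assms c unfolding C1_fun_def by (blast intro: C1_continuous_on)
    from continuous_on_compose2[OF this continuous_chart[OF c(1)] order_refl]
    have "continuous_on (fst c) (\<lambda>q. (f \<circ> chart_inv c) (snd c q))" .
    then have "continuous_on (fst c) f" using c by (simp cong: continuous_on_cong)
    then show ?thesis using c open_dom by blast
  qed
  then show ?thesis
    by (metis continuous_at_imp_continuous_on continuous_on_eq_continuous_at)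
qed

text \<open>
  A plateau function in the coordinates of one chart, extended by zero.  The extension is
  continuously differentiable in every other chart because its support is compact, hence closed.
\<close>

lemma ex_bump:
  fixes p :: 'm
  obtains c Q P and \<psi> :: "'m \<Rightarrow> real"
  where "c \<in> A" "compact Q" "Q \<subseteq> fst c" "open P" "p \<in> P" "C1_fun A \<psi>"
    "\<And>q. q \<notin> Q \<Longrightarrow> \<psi> q = 0" "\<And>q. q \<in> P \<Longrightarrow> \<psi> q = 1"
proof -
  obtain c where c: "c \<in> A" "p \<in> fst c" by (rule chart_cases)
  let ?x = "snd c p" and ?U = "snd c ` fst c"
  obtain r where r: "r > 0" "cball ?x r \<subseteq> ?U"
    using open_img[OF c(1)] c(2) open_contains_cball by (metis imageI)
  \<comment> \<open>1 where the inner argument is at most 0, and 0 where it is at least 1\<close>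
  define b where
    "b x = pos_square (1 - pos_square (2 / r\<^sup>2 * ((x - ?x) \<bullet> (x - ?x)) - 1))" for x
  have C1_id: "C1 (\<lambda>x :: real^'n. x) UNIV"
    by (rule C1I[where f' = "\<lambda>_ v. v"]) auto
  have C1b: "C1 b UNIV"
    unfolding b_def
    by (intro C1_pos_square C1_diff C1_mult C1_inner C1_const C1_id)
  have b0: "b x = 0" if "x \<notin> cball ?x r" for x
  proof -
    have "r\<^sup>2 \<le> (norm (x - ?x))\<^sup>2"
      using that r(1) by (intro power_mono) (auto simp: dist_norm norm_minus_commute)
    then have "1 \<le> 2 / r\<^sup>2 * ((x - ?x) \<bullet> (x - ?x)) - 1"
      using r(1) by (simp add: power2_norm_eq_inner field_simps)
    then have "1 \<le> pos_square (2 / r\<^sup>2 * ((x - ?x) \<bullet> (x - ?x)) - 1)"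
      by (subst pos_square_simps(2)) (auto simp: one_le_power)
    then show ?thesis by (simp add: b_def pos_square_simps(1))
  qed
  have b1: "b x = 1" if "x \<in> ball ?x (r / 2)" for x
  proof -
    have "(norm (x - ?x))\<^sup>2 \<le> (r / 2)\<^sup>2"
      using that by (intro power_mono) (auto simp: dist_norm norm_minus_commute)
    then have "4 * ((x - ?x) \<bullet> (x - ?x)) \<le> r\<^sup>2"
      by (simp add: power2_norm_eq_inner power_divide)
    then have "2 * ((x - ?x) \<bullet> (x - ?x)) \<le> r\<^sup>2"
      by (smt (verit) inner_ge_zero)
    then have "2 / r\<^sup>2 * ((x - ?x) \<bullet> (x - ?x)) - 1 \<le> 0"
      using r(1) by (simp add: field_simps)
    then show ?thesis by (simp add: b_def pos_square_simps(1,2))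
  qed
  define \<psi> where "\<psi> q = (if q \<in> fst c then b (snd c q) else 0)" for q
  define Q where "Q = chart_inv c ` cball ?x r"
  have Q: "compact Q" "Q \<subseteq> fst c"
    unfolding Q_def using r(2) chart_inv_mem[OF c(1)]
    by (auto intro!: compact_continuous_image continuous_on_subset[OF continuous_chart_inv[OF c(1)]])
  have \<psi>0: "\<psi> q = 0" if "q \<notin> Q" for q
  proof (cases "q \<in> fst c")
    case True
    then have "snd c q \<notin> cball ?x r" using that c(1) unfolding Q_def by force
    then show ?thesis using b0 by (simp add: \<psi>_def)
  qed (simp add: \<psi>_def)
  have "C1_fun A \<psi>"
    unfolding C1_fun_def
  proof
    fix d assume d: "d \<in> A"
    let ?S = "snd d ` (fst d \<inter> fst c)" and ?R = "snd d ` (fst d \<inter> - Q)"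
    have S: "open ?S" "open ?R"
      using open_chart_image[OF d] open_dom[OF c(1)] compact_imp_closed[OF Q(1)] by auto
    have 1: "C1 (\<psi> \<circ> chart_inv d) ?S"
      by (rule C1_cong[OF C1_compose[OF C1_transition[OF d c(1)] C1b subset_UNIV] S(1)])
         (use d c in \<open>auto simp: \<psi>_def\<close>)
    have 2: "C1 (\<psi> \<circ> chart_inv d) ?R"
      by (rule C1_cong[OF C1_const[of 0] S(2)]) (use d \<psi>0 in auto)
    have "?S \<union> ?R = snd d ` fst d" using Q(2) by auto
    then show "C1 (\<psi> \<circ> chart_inv d) (snd d ` fst d)" using C1_union[OF 1 2 S] by simp
  qed
  moreover
  define P where "P = snd c -` ball ?x (r / 2) \<inter> fst c"
  have "open P"
    unfolding P_def using continuous_chart[OF c(1)] open_dom[OF c(1)]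
    by (simp add: continuous_on_open_vimage)
  moreover have "p \<in> P" "\<And>q. q \<in> P \<Longrightarrow> \<psi> q = 1"
    using c r b1 by (auto simp: P_def \<psi>_def)
  ultimately show ?thesis using that[OF c(1) Q] \<psi>0 by blast
qed

end

section \<open>The divergence theorem on an immersed hypersurface\<close>

locale immersed_hypersurface = manifold A
  for A :: "('m::{t2_space, second_countable_topology}, 'n::finite) chart set" +
  fixes X N :: "'m \<Rightarrow> 'e::euclidean_space" and \<mu> :: "'m measure"
  assumes immersion: "smooth_immersion A X"
    and normal: "unit_normal A X N"
    and codim: "DIM('e) = CARD('n) + 1"
    and area_measure: "is_area_measure A X \<mu>"
begin

lemma sets_\<mu> [measurable_cong, simp]: "sets \<mu> = sets borel"
  using area_measure by (simp add: is_area_measure_def)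

lemma space_\<mu> [simp]: "space \<mu> = UNIV"
  using sets_eq_imp_space_eq[OF sets_\<mu>] by simp

lemma C1_X: "C1_fun A X"
  using immersion open_img
  by (auto simp: C1_fun_def smooth_immersion_def smooth_map_def intro: smooth_on_C1)

lemma C1_N: "C1_fun A N"
  using normal open_img
  by (auto simp: C1_fun_def unit_normal_def smooth_map_def intro: smooth_on_C1)

lemma parametrization:
  assumes c: "c \<in> A"
  shows "parametrized_hypersurface (snd c ` fst c) (X \<circ> chart_inv c) (N \<circ> chart_inv c)"
proof
  have dX: "frechet_derivative (X \<circ> chart_inv c) (at x) = chart_deriv c X (chart_inv c x)"
    if "x \<in> snd c ` fst c" for x
    using that c by (simp add: chart_deriv_def)
  show "C1 (\<lambda>x. frechet_derivative (X \<circ> chart_inv c) (at x) v) (snd c ` fst c)" for v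
    using immersion c open_img[OF c]
    by (intro smooth_on_C1) (auto simp: smooth_immersion_def smooth_map_def)
  fix x assume x: "x \<in> snd c ` fst c"
  show "inj (frechet_derivative (X \<circ> chart_inv c) (at x))"
    using immersion c chart_inv_mem[OF c x] by (simp add: dX[OF x] smooth_immersion_def)
  show "(N \<circ> chart_inv c) x \<bullet> (N \<circ> chart_inv c) x = 1"
    using normal by (simp add: unit_normal_def norm_eq_1[symmetric])
  show "(N \<circ> chart_inv c) x \<bullet> frechet_derivative (X \<circ> chart_inv c) (at x) v = 0" for v
    using normal c chart_inv_mem[OF c x] by (simp add: dX[OF x] unit_normal_def)
qed (use c C1_X C1_N open_img codim in \<open>auto simp: C1_fun_def\<close>)

lemma chart_deriv_X:
  assumes "c \<in> A" "p \<in> fst c"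
  shows "linear (chart_deriv c X p)" "inj (chart_deriv c X p)"
  using parametrized_hypersurface.linear_dY[OF parametrization[OF assms(1)], of "snd c p"]
    parametrized_hypersurface.inj_dY[OF parametrization[OF assms(1)], of "snd c p"] assms(2)
  by (auto simp: chart_deriv_def)

text \<open>
  The mean curvature is computed in some chart and frame; the transition map carries that frame to
  an orthonormal frame of the given chart with the same second fundamental form.  Thus its value is
  available in every chart without comparing different frames at a point.
\<close>

lemma mean_curvature_frame:
  assumes c: "c \<in> A" "p \<in> fst c"
  shows "\<exists>e. orthonormal_frame c X p e \<and>
    mean_curvature A X N p = (\<Sum>i\<in>UNIV. second_ff c X N p (e i) (e i))"
proof -
  obtain e\<^sub>0 where "orthonormal_frame c X p e\<^sub>0"
    using ex_orthonormal_preimages[OF chart_deriv_X[OF c]]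
    by (metis orthonormal_frame_def induced_metric_def)
  then have "\<exists>H. \<exists>c\<in>A. \<exists>e. p \<in> fst c \<and> orthonormal_frame c X p e \<and>
      H = (\<Sum>i\<in>UNIV. second_ff c X N p (e i) (e i))" using c by blast
  then have "\<exists>c\<in>A. \<exists>e. p \<in> fst c \<and> orthonormal_frame c X p e \<and>
      mean_curvature A X N p = (\<Sum>i\<in>UNIV. second_ff c X N p (e i) (e i))"
    unfolding mean_curvature_def by (rule someI_ex)
  then obtain d e where d: "d \<in> A" "p \<in> fst d" and e: "orthonormal_frame d X p e"
    and H: "mean_curvature A X N p = (\<Sum>i\<in>UNIV. second_ff d X N p (e i) (e i))" by blast
  obtain T where T: "\<And>f v. C1_fun A f \<Longrightarrow> chart_deriv d (f :: 'm \<Rightarrow> 'e) p v = chart_deriv c f p (T v)"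
    using chart_deriv_transition[OF d(1) c(1) d(2) c(2)] by metis
  show ?thesis
    by (rule exI[of _ "T \<circ> e"])
       (use e H in \<open>simp add: orthonormal_frame_def induced_metric_def second_ff_def T C1_X C1_N\<close>)
qed

definition half_tangent_at :: "('m, 'n) chart \<Rightarrow> 'm \<Rightarrow> real^'n" where
  "half_tangent_at c p = parametrized_hypersurface.half_tangent (X \<circ> chart_inv c) (snd c p)"

lemma chart_deriv_half_tangent_at:
  assumes "c \<in> A" "p \<in> fst c"
  shows "chart_deriv c X p (half_tangent_at c p) = (1/2) *\<^sub>R (X p - (X p \<bullet> N p) *\<^sub>R N p)"
  using parametrized_hypersurface.dY_half_tangent[OF parametrization[OF assms(1)], of "snd c p"] assms
  by (simp add: chart_deriv_def half_tangent_at_def)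

text \<open>
  The inner product of the gradients of \<open>\<phi>\<close> and of \<open>|X|\<^sup>2 / 4\<close>.
\<close>

definition grad_deriv :: "('m \<Rightarrow> real) \<Rightarrow> 'm \<Rightarrow> real" where
  "grad_deriv \<phi> p = (SOME D. \<exists>c\<in>A. p \<in> fst c \<and> D = chart_deriv c \<phi> p (half_tangent_at c p))"

text \<open>
  The coordinate vectors \<open>half_tangent_at\<close> in two charts represent the same tangent vector, as they
  have the same image under the injective differential of \<open>X\<close>.
\<close>

lemma grad_deriv_chart:
  assumes \<phi>: "C1_fun A \<phi>" and c: "c \<in> A" "p \<in> fst c"
  shows "grad_deriv \<phi> p = chart_deriv c \<phi> p (half_tangent_at c p)"
proof -
  have "\<exists>D. \<exists>c\<in>A. p \<in> fst c \<and> D = chart_deriv c \<phi> p (half_tangent_at c p)" using c by blast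
  then have "\<exists>c\<in>A. p \<in> fst c \<and> grad_deriv \<phi> p = chart_deriv c \<phi> p (half_tangent_at c p)"
    unfolding grad_deriv_def by (rule someI_ex)
  then obtain d where d: "d \<in> A" "p \<in> fst d"
    "grad_deriv \<phi> p = chart_deriv d \<phi> p (half_tangent_at d p)" by blast
  obtain T where TX: "\<And>v. chart_deriv d X p v = chart_deriv c X p (T v)"
    and T\<phi>: "\<And>v. chart_deriv d \<phi> p v = chart_deriv c \<phi> p (T v)"
    using chart_deriv_transition[OF d(1) c(1) d(2) c(2)] C1_X \<phi> by metis
  have "chart_deriv c X p (T (half_tangent_at d p)) = chart_deriv c X p (half_tangent_at c p)"
    unfolding TX[symmetric] chart_deriv_half_tangent_at[OF d(1,2)] chart_deriv_half_tangent_at[OF c] ..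
  then have "T (half_tangent_at d p) = half_tangent_at c p"
    using chart_deriv_X(2)[OF c] by (simp add: inj_eq)
  then show ?thesis by (simp add: d(3) T\<phi>)
qed

lemma grad_deriv_add:
  assumes "C1_fun A \<phi>" "C1_fun A \<psi>"
  shows "grad_deriv (\<lambda>p. \<phi> p + \<psi> p) p = grad_deriv \<phi> p + grad_deriv \<psi> p"
proof -
  obtain c where c: "c \<in> A" "p \<in> fst c" by (rule chart_cases)
  have D: "(f \<circ> chart_inv c has_derivative frechet_derivative (f \<circ> chart_inv c) (at (snd c p)))
      (at (snd c p))" if "C1_fun A f" for f :: "'m \<Rightarrow> real"
    using that c by (intro C1_has_derivative) (auto simp: C1_fun_def)
  have "((\<lambda>p. \<phi> p + \<psi> p) \<circ> chart_inv c has_derivative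
      (\<lambda>v. chart_deriv c \<phi> p v + chart_deriv c \<psi> p v)) (at (snd c p))"
    using has_derivative_add[OF D[OF assms(1)] D[OF assms(2)]] by (simp add: o_def chart_deriv_def)
  from frechet_derivative_at[OF this, symmetric] show ?thesis
    using c by (simp add: grad_deriv_chart C1_fun_add assms) (simp add: chart_deriv_def)
qed

lemma area_density_in_chart:
  assumes c: "c \<in> A" and x: "x \<in> snd c ` fst c"
  shows "area_density c X (chart_inv c x) = parametrized_hypersurface.area (X \<circ> chart_inv c) x"
  using assms by (simp add: area_density_def gram_def induced_metric_def chart_deriv_def
      parametrized_hypersurface.area_def[OF parametrization[OF c]])

text \<open>
  On the chart domain \<open>\<mu>\<close> is the image under \<open>chart_inv c\<close> of Lebesgue measure with the area
  density.
\<close>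

lemma has_integral_in_chart:
  assumes c: "c \<in> A" and out: "\<And>p. p \<notin> fst c \<Longrightarrow> \<Psi> p = 0"
    and int: "has_bochner_integral lborel
      (\<lambda>x. indicator (snd c ` fst c) x * (area_density c X (chart_inv c x) * \<Psi> (chart_inv c x))) I"
  shows "has_bochner_integral \<mu> (\<Psi> :: 'm \<Rightarrow> real) I"
proof -
  let ?U = "snd c ` fst c"
  define w where "w x = area_density c X (chart_inv c x)" for x
  have w_area: "w x = parametrized_hypersurface.area (X \<circ> chart_inv c) x" if "x \<in> ?U" for x
    using area_density_in_chart[OF c that] by (simp add: w_def)
  have w_pos: "w x > 0" if "x \<in> ?U" for x
    using w_area parametrized_hypersurface.area_pos[OF parametrization[OF c]] that by simp
  have w_cont: "continuous_on ?U w"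
    using C1_continuous_on[OF parametrized_hypersurface.C1_area[OF parametrization[OF c]]] w_area
    by (simp cong: continuous_on_cong)
  have U [measurable]: "?U \<in> sets borel" and D [measurable]: "fst c \<in> sets borel"
    using open_img[OF c] open_dom[OF c] by auto
  let ?R = "restrict_space borel ?U" and ?L = "restrict_space lborel ?U"
  have w_meas [measurable]: "w \<in> borel_measurable ?R"
    by (rule borel_measurable_continuous_on_restrict[OF w_cont])
  have sets_L: "sets ?L = sets ?R" by (rule sets_restrict_space_cong) simp
  have w_measL: "w \<in> borel_measurable ?L"
    using w_meas by (simp add: measurable_def sets_L space_restrict_space)
  have inv_meas: "chart_inv c \<in> measurable ?R (restrict_space borel (fst c))"
    by (intro measurable_restrict_space2 borel_measurable_continuous_on_restrict
        continuous_chart_inv[OF c]) (auto simp: space_restrict_space chart_inv_mem[OF c])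
  let ?\<nu> = "density ?L (\<lambda>x. ennreal (w x))"
  have inv_meas': "chart_inv c \<in> measurable ?\<nu> (restrict_space borel (fst c))"
    using inv_meas by (simp add: measurable_def sets_L space_restrict_space)
  have eq: "restrict_space \<mu> (fst c) = distr ?\<nu> (restrict_space borel (fst c)) (chart_inv c)"
  proof (rule measure_eqI)
    show "sets (restrict_space \<mu> (fst c)) = sets (distr ?\<nu> (restrict_space borel (fst c)) (chart_inv c))"
      by (simp add: sets_restrict_space)
    fix B assume "B \<in> sets (restrict_space \<mu> (fst c))"
    then have B: "B \<in> sets borel" "B \<subseteq> fst c"
      by (auto simp: sets_restrict_space_iff)
    have Bm: "B \<in> sets (restrict_space borel (fst c))" using B by (simp add: sets_restrict_space_iff)
    have pre: "chart_inv c -` B \<inter> ?U = snd c ` B"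
      using chart_image_eq[OF c B(2)] by auto
    have preL: "snd c ` B \<in> sets ?L"
      using measurable_sets[OF inv_meas' Bm] by (simp add: space_restrict_space pre)
    have "emeasure (restrict_space \<mu> (fst c)) B = emeasure \<mu> B"
      using B(2) by (subst emeasure_restrict_space) auto
    also have "\<dots> = (\<integral>\<^sup>+x\<in>snd c ` B. ennreal (w x) \<partial>lborel)"
      using area_measure c B unfolding is_area_measure_def w_def by blast
    also have "\<dots> = (\<integral>\<^sup>+x. ennreal (w x) * indicator (snd c ` B) x * indicator ?U x \<partial>lborel)"
      using B(2) by (intro nn_integral_cong) (auto simp: indicator_def)
    also have "\<dots> = (\<integral>\<^sup>+x. ennreal (w x) * indicator (snd c ` B) x \<partial>?L)"
      by (subst nn_integral_restrict_space) auto
    also have "\<dots> = emeasure ?\<nu> (snd c ` B)"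
      by (intro emeasure_density[symmetric] preL measurable_compose[OF w_measL measurable_ennreal])
    also have "\<dots> = emeasure (distr ?\<nu> (restrict_space borel (fst c)) (chart_inv c)) B"
      by (subst emeasure_distr[OF inv_meas' Bm]) (simp add: space_restrict_space pre)
    finally show "emeasure (restrict_space \<mu> (fst c)) B = \<dots>" .
  qed
  \<comment> \<open>the density is positive, so measurability of the product in coordinates gives that of the function itself\<close>
  have \<Psi>_meas: "\<Psi> \<in> borel_measurable (restrict_space borel (fst c))"
  proof -
    let ?G = "\<lambda>x. indicator ?U x * (w x * \<Psi> (chart_inv c x))"
    have G: "?G \<in> borel_measurable borel"
      using int by (auto simp: has_bochner_integral_iff w_def)
    have "snd c \<in> measurable (restrict_space borel (fst c)) ?R"
      by (intro measurable_restrict_space2 borel_measurable_continuous_on_restrict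
          continuous_chart[OF c]) (auto simp: space_restrict_space)
    from measurable_compose[OF this measurable_restrict_space1[OF G]] measurable_compose[OF this w_meas]
    have "(\<lambda>p. ?G (snd c p) / w (snd c p)) \<in> borel_measurable (restrict_space borel (fst c))"
      by (rule borel_measurable_divide)
    moreover have "?G (snd c p) / w (snd c p) = \<Psi> p" if "p \<in> fst c" for p
      using w_pos[of "snd c p"] that c by simp
    ultimately show ?thesis
      by (subst measurable_cong[of _ _ "\<lambda>p. ?G (snd c p) / w (snd c p)"])
         (auto simp: space_restrict_space)
  qed
  have "has_bochner_integral ?L (\<lambda>x. w x *\<^sub>R \<Psi> (chart_inv c x)) I"
    using int unfolding has_bochner_integral_iff
    by (auto simp: integrable_restrict_space integral_restrict_space w_def set_integrable_def)
  then have "has_bochner_integral ?\<nu> (\<lambda>x. \<Psi> (chart_inv c x)) I"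
    using w_meas measurable_compose[OF inv_meas \<Psi>_meas] w_pos
    by (intro has_bochner_integral_density)
       (auto simp: measurable_def sets_L space_restrict_space less_imp_le)
  then have "has_bochner_integral (restrict_space \<mu> (fst c)) \<Psi> I"
    unfolding eq by (rule has_bochner_integral_distr[OF \<Psi>_meas inv_meas'])
  then have "has_bochner_integral \<mu> (\<lambda>p. indicator (fst c) p *\<^sub>R \<Psi> p) I"
    unfolding has_bochner_integral_iff
    by (auto simp: integrable_restrict_space integral_restrict_space set_integrable_def)
  moreover have "indicator (fst c) p *\<^sub>R \<Psi> p = \<Psi> p" for p
    using out[of p] by (auto simp: indicator_def)
  ultimately show ?thesis by (simp only:)
qed

text \<open>
  The Laplacian of \<open>|X|\<^sup>2 / 4\<close> in the induced metric.
\<close>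

definition potential_laplacian :: "'m \<Rightarrow> real" where
  "potential_laplacian p = (real CARD('n) + (X p \<bullet> N p) * mean_curvature A X N p) / 2"

lemma divergence_theorem_in_chart:
  assumes \<phi>: "C1_fun A \<phi>" and c: "c \<in> A" and Q: "compact Q" "Q \<subseteq> fst c"
    and zero: "\<And>p. p \<notin> Q \<Longrightarrow> \<phi> p = 0"
  shows "has_bochner_integral \<mu> (\<lambda>p. grad_deriv \<phi> p + \<phi> p * potential_laplacian p) 0"
proof (rule has_integral_in_chart[OF c])
  let ?U = "snd c ` fst c" and ?Y = "X \<circ> chart_inv c" and ?\<nu> = "N \<circ> chart_inv c"
  interpret S: parametrized_hypersurface ?U ?Y ?\<nu> by (rule parametrization[OF c])
  fix p assume p: "p \<notin> fst c"
  obtain d where d: "d \<in> A" "p \<in> fst d" by (rule chart_cases)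
  have "open (snd d ` (fst d \<inter> - Q))"
    using open_chart_image[OF d(1)] compact_imp_closed[OF Q(1)] by auto
  then have "(\<phi> \<circ> chart_inv d has_derivative (\<lambda>_. 0)) (at (snd d p))"
    by (rule has_derivative_transform_within_open[OF has_derivative_const[of 0]])
       (use d p Q(2) zero in auto)
  from frechet_derivative_at[OF this, symmetric]
  have "grad_deriv \<phi> p = 0"
    by (simp add: grad_deriv_chart[OF \<phi> d] chart_deriv_def)
  then show "grad_deriv \<phi> p + \<phi> p * potential_laplacian p = 0" using zero p Q(2) by auto
next
  let ?U = "snd c ` fst c" and ?Y = "X \<circ> chart_inv c" and ?\<nu> = "N \<circ> chart_inv c"
  interpret S: parametrized_hypersurface ?U ?Y ?\<nu> by (rule parametrization[OF c])
  have K: "compact (snd c ` Q)" "snd c ` Q \<subseteq> ?U"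
    using Q continuous_on_subset[OF continuous_chart[OF c]] by (auto intro: compact_continuous_image)
  have C1: "C1 (\<phi> \<circ> chart_inv c) ?U" using \<phi> c by (simp add: C1_fun_def)
  have "has_bochner_integral lborel (\<lambda>x. indicator ?U x * (S.area x *
     (frechet_derivative (\<phi> \<circ> chart_inv c) (at x) (S.half_tangent x)
       + (\<phi> \<circ> chart_inv c) x * ((real CARD('n) + (?Y x \<bullet> ?\<nu> x)
         * (mean_curvature A X N \<circ> chart_inv c) x) / 2)))) 0"
  proof (rule S.local_divergence_theorem[OF C1 K])
    show "(\<phi> \<circ> chart_inv c) x = 0" if "x \<in> ?U" "x \<notin> snd c ` Q" for x
      using that zero c by force
    show "\<exists>e. (\<forall>i j :: 'n. S.dY x (e i) \<bullet> S.dY x (e j) = (if i = j then 1 else 0)) \<and>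
        (mean_curvature A X N \<circ> chart_inv c) x = (\<Sum>i\<in>UNIV. - (S.d\<nu> x (e i) \<bullet> S.dY x (e i)))"
      if "x \<in> ?U" for x
      using mean_curvature_frame[OF c chart_inv_mem[OF c that]] that c
      by (simp add: orthonormal_frame_def induced_metric_def second_ff_def chart_deriv_def
          split del: if_split)
  qed
  moreover have "indicator ?U x * (S.area x *
     (frechet_derivative (\<phi> \<circ> chart_inv c) (at x) (S.half_tangent x)
       + (\<phi> \<circ> chart_inv c) x * ((real CARD('n) + (?Y x \<bullet> ?\<nu> x)
         * (mean_curvature A X N \<circ> chart_inv c) x) / 2)))
    = indicator ?U x * (area_density c X (chart_inv c x) *
     (grad_deriv \<phi> (chart_inv c x) + \<phi> (chart_inv c x) * potential_laplacian (chart_inv c x)))" for x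
  proof (cases "x \<in> ?U")
    case True
    then show ?thesis
      using c by (simp add: grad_deriv_chart[OF \<phi> c chart_inv_mem[OF c]] chart_deriv_def
          half_tangent_at_def potential_laplacian_def area_density_def S.area_def gram_def induced_metric_def)
  qed simp
  ultimately show "has_bochner_integral lborel (\<lambda>x. indicator ?U x * (area_density c X (chart_inv c x) *
     (grad_deriv \<phi> (chart_inv c x) + \<phi> (chart_inv c x) * potential_laplacian (chart_inv c x)))) 0"
    by (simp only:)
qed

text \<open>
  Induction on the number of plateaus needed to cover the support: with a plateau function \<open>\<psi>\<close>, the
  product \<open>\<phi> \<psi>\<close> is supported in one chart, and \<open>\<phi> (1 - \<psi>)\<close> vanishes on the plateau of \<open>\<psi>\<close>, so that
  one plateau fewer covers its support.
\<close>

theorem divergence_theorem: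
  assumes "C1_fun A \<phi>" "compact K" "\<And>p. p \<notin> K \<Longrightarrow> \<phi> p = 0"
  shows "has_bochner_integral \<mu> (\<lambda>p. grad_deriv \<phi> p + \<phi> p * potential_laplacian p) 0"
proof -
  define good where "good P \<longleftrightarrow> open P \<and> (\<exists>c\<in>A. \<exists>Q \<psi>. compact Q \<and> Q \<subseteq> fst c \<and> C1_fun A \<psi> \<and>
    (\<forall>q. q \<notin> Q \<longrightarrow> \<psi> q = (0::real)) \<and> (\<forall>q\<in>P. \<psi> q = 1))" for P
  have main: "has_bochner_integral \<mu> (\<lambda>p. grad_deriv \<phi> p + \<phi> p * potential_laplacian p) 0"
    if "finite F" "\<forall>P\<in>F. good P" "C1_fun A \<phi>" "compact K" "K \<subseteq> \<Union>F" "\<forall>p. p \<notin> K \<longrightarrow> \<phi> p = 0"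
    for F K \<phi>
    using that
  proof (induction F arbitrary: K \<phi> rule: finite_induct)
    case empty
    obtain c where c: "c \<in> A" using chart_cases by blast
    show ?case
      by (rule divergence_theorem_in_chart[OF empty(2) c compact_empty]) (use empty in auto)
  next
    case (insert P F)
    obtain c Q \<psi> where b: "open P" "c \<in> A" "compact Q" "Q \<subseteq> fst c" "C1_fun A \<psi>"
      "\<And>q. q \<notin> Q \<Longrightarrow> \<psi> q = 0" "\<And>q. q \<in> P \<Longrightarrow> \<psi> q = (1::real)"
      using insert.prems(1) unfolding good_def by (metis insertI1)
    let ?f = "\<lambda>p. \<phi> p * \<psi> p" and ?g = "\<lambda>p. \<phi> p * (1 - \<psi> p)"
    have C1: "C1_fun A ?f" "C1_fun A ?g"
      using insert.prems(2) b(5) by (auto intro!: C1_fun_mult C1_fun_diff C1_fun_const)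
    have "has_bochner_integral \<mu> (\<lambda>p. grad_deriv ?f p + ?f p * potential_laplacian p) 0"
      by (rule divergence_theorem_in_chart[OF C1(1) b(2-4)]) (simp add: b(6))
    moreover have "has_bochner_integral \<mu> (\<lambda>p. grad_deriv ?g p + ?g p * potential_laplacian p) 0"
    proof (rule insert.IH[OF _ C1(2)])
      show "compact (K - P)" using insert.prems(3) b(1) by (rule compact_diff)
    qed (use insert.prems b(7) in auto)
    ultimately have "has_bochner_integral \<mu> (\<lambda>p. (grad_deriv ?f p + ?f p * potential_laplacian p)
        + (grad_deriv ?g p + ?g p * potential_laplacian p)) (0 + 0)"
      by (rule has_bochner_integral_add)
    moreover have "(\<lambda>p. ?f p + ?g p) = \<phi>" by (simp add: algebra_simps)
    then have "grad_deriv \<phi> p = grad_deriv ?f p + grad_deriv ?g p" for p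
      using grad_deriv_add[OF C1, of p] by simp
    ultimately show ?case by (simp add: algebra_simps)
  qed
  have "\<exists>P. p \<in> P \<and> good P" for p
    using ex_bump[of p] unfolding good_def by metis
  then have "K \<subseteq> \<Union> (Collect good)" by blast
  moreover have "\<forall>P\<in>Collect good. open P" by (auto simp: good_def)
  ultimately obtain F where "F \<subseteq> Collect good" "finite F" "K \<subseteq> \<Union>F"
    using assms(2) by (meson compactE)
  with main[of F \<phi> K] assms show ?thesis by blast
qed

section \<open>The quarter of the squared distance to the origin\<close>

definition potential :: "'m \<Rightarrow> real" where
  "potential p = (X p \<bullet> X p) / 4"

lemma potential_nonneg: "0 \<le> potential p"
  by (simp add: potential_def)

text \<open>
  The squared length of the gradient of \<open>potential\<close>, a quarter of the squared length of the
  tangential part of \<open>X\<close>.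
\<close>

definition potential_grad_sq :: "'m \<Rightarrow> real" where
  "potential_grad_sq p = (X p \<bullet> X p - (X p \<bullet> N p)\<^sup>2) / 4"

lemma C1_potential: "C1_fun A potential"
  using C1_fun_mult[OF C1_fun_inner[OF C1_X C1_X] C1_fun_const[of _ "1/4"]]
  by (simp add: potential_def[abs_def])

lemma grad_deriv_of_potential:
  assumes C1: "C1_fun A (\<lambda>q. \<Phi> (potential q))" and \<Phi>: "(\<Phi> has_real_derivative \<Phi>') (at (potential p))"
  shows "grad_deriv (\<lambda>q. \<Phi> (potential q)) p = \<Phi>' * potential_grad_sq p"
proof -
  obtain c where c: "c \<in> A" "p \<in> fst c" by (rule chart_cases)
  let ?Y = "X \<circ> chart_inv c" and ?x = "snd c p"
  have Y: "(?Y has_derivative chart_deriv c X p) (at ?x)"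
    using C1_has_derivative[of ?Y "snd c ` fst c" ?x] C1_X c
    by (auto simp: C1_fun_def chart_deriv_def)
  have "((\<lambda>x. ?Y x \<bullet> ?Y x * (1/4)) has_derivative
      (\<lambda>v. (?Y ?x \<bullet> chart_deriv c X p v + chart_deriv c X p v \<bullet> ?Y ?x) * (1/4))) (at ?x)"
    by (intro has_derivative_mult_left has_derivative_inner Y)
  then have "((\<lambda>x. potential (chart_inv c x)) has_derivative (\<lambda>v. (X p \<bullet> chart_deriv c X p v) / 2)) (at ?x)"
    using c by (simp add: potential_def inner_commute)
  from has_derivative_compose[OF this, of \<Phi> "(*) \<Phi>'"] \<Phi> c
  have "((\<lambda>q. \<Phi> (potential q)) \<circ> chart_inv c has_derivative
      (\<lambda>v. \<Phi>' * ((X p \<bullet> chart_deriv c X p v) / 2))) (at ?x)"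
    by (simp add: has_field_derivative_def o_def)
  from frechet_derivative_at[OF this, symmetric]
  have "grad_deriv (\<lambda>q. \<Phi> (potential q)) p = \<Phi>' * ((X p \<bullet> chart_deriv c X p (half_tangent_at c p)) / 2)"
    by (simp add: grad_deriv_chart[OF C1 c]) (simp add: chart_deriv_def)
  then show ?thesis
    unfolding chart_deriv_half_tangent_at[OF c]
    by (simp add: potential_grad_sq_def inner_diff_right power2_eq_square)
qed

text \<open>
  Every point has a neighbourhood inside a compact subset of a chart domain, where the area density
  is bounded.
\<close>

lemma emeasure_compact_finite:
  assumes "compact K" shows "emeasure \<mu> K < \<infinity>"
proof -
  have loc: "\<exists>P. open P \<and> p \<in> P \<and> emeasure \<mu> P < \<infinity>" for p
  proof -
    obtain c Q P \<psi> where b: "c \<in> A" "compact Q" "Q \<subseteq> fst c" "open P" "p \<in> P"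
      "\<And>q. q \<notin> Q \<Longrightarrow> \<psi> q = 0" "\<And>q. q \<in> P \<Longrightarrow> \<psi> q = (1::real)" using ex_bump[of p] by metis
    have "P \<subseteq> Q" using b(6,7) by force
    have Qb: "Q \<in> sets borel" using b(2) by (simp add: compact_imp_closed)
    let ?w = "\<lambda>x. area_density c X (chart_inv c x)" and ?U = "snd c ` fst c"
    interpret S: parametrized_hypersurface ?U "X \<circ> chart_inv c" "N \<circ> chart_inv c"
      by (rule parametrization[OF b(1)])
    have sub: "snd c ` Q \<subseteq> ?U" using b(3) by auto
    have "compact (snd c ` Q)"
      using b(2,3) continuous_on_subset[OF continuous_chart[OF b(1)]] by (auto intro: compact_continuous_image)
    moreover have "continuous_on (snd c ` Q) ?w"
      using continuous_on_subset[OF C1_continuous_on[OF S.C1_area] sub] area_density_in_chart[OF b(1)] sub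
      by (subst continuous_on_cong[OF refl, of _ _ S.area]) auto
    ultimately have "integrable lborel (\<lambda>x. indicator (snd c ` Q) x *\<^sub>R ?w x)"
      by (rule borel_integrable_compact)
    then have fin: "(\<integral>\<^sup>+x. ennreal (norm (indicator (snd c ` Q) x *\<^sub>R ?w x)) \<partial>lborel) < \<infinity>"
      by (simp only: integrable_iff_bounded)
    have "emeasure \<mu> Q = (\<integral>\<^sup>+x\<in>snd c ` Q. ennreal (?w x) \<partial>lborel)"
      using area_measure b(1,3) Qb unfolding is_area_measure_def by blast
    also have "\<dots> \<le> (\<integral>\<^sup>+x. ennreal (norm (indicator (snd c ` Q) x *\<^sub>R ?w x)) \<partial>lborel)"
      by (intro nn_integral_mono) (auto simp: indicator_def intro!: ennreal_leI)
    also note fin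
    finally have "emeasure \<mu> Q < \<infinity>" .
    moreover have "emeasure \<mu> P \<le> emeasure \<mu> Q" by (rule emeasure_mono[OF \<open>P \<subseteq> Q\<close>]) (simp add: Qb)
    ultimately have "emeasure \<mu> P < \<infinity>" by (rule le_less_trans[rotated])
    then show ?thesis using b(4,5) by blast
  qed
  let ?\<P> = "{P. open P \<and> emeasure \<mu> P < \<infinity>}"
  have "K \<subseteq> \<Union>?\<P>" using loc by blast
  then obtain F where F: "F \<subseteq> ?\<P>" "finite F" "K \<subseteq> \<Union>F"
    using assms by (metis (no_types, lifting) compactE mem_Collect_eq)
  have "emeasure \<mu> (\<Union>F) < \<infinity> \<and> open (\<Union>F)"
    using F(2,1)
  proof (induction F rule: finite_induct)
    case (insert P F)
    have "emeasure \<mu> (P \<union> \<Union>F) \<le> emeasure \<mu> P + emeasure \<mu> (\<Union>F)"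
      using insert by (intro emeasure_subadditive) auto
    also have "\<dots> < \<infinity>" using insert by auto
    finally show ?case using insert by auto
  qed simp
  then show ?thesis
    using emeasure_mono[OF F(3), of \<mu>] by (auto intro: le_less_trans)
qed

end

section \<open>Exponentially weighted integrals\<close>

text \<open>
  The integral on the left of the moment hypothesis is minus the derivative of
  \<open>J \<tau> = \<integral> \<eta> exp (- \<tau> y)\<close>, so the hypothesis says that \<open>\<tau> powr k * J \<tau>\<close> has a nonnegative derivative
  up to \<open>\<tau> = 1\<close>.
\<close>

lemma exponential_weight_bound:
  fixes y \<eta> :: "'m \<Rightarrow> real"
  assumes [measurable]: "y \<in> borel_measurable M" "\<eta> \<in> borel_measurable M" "K \<in> sets M"
    and K: "emeasure M K < \<infinity>" "\<And>p. p \<notin> K \<Longrightarrow> \<eta> p = 0" "\<And>p. p \<in> K \<Longrightarrow> y p \<le> S"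
    and y: "\<And>p. 0 \<le> y p" and \<eta>: "\<And>p. 0 \<le> \<eta> p" "\<And>p. \<eta> p \<le> 1"
    and moment: "\<And>\<tau>. 0 < \<tau> \<Longrightarrow> \<tau> \<le> 1 \<Longrightarrow>
      \<tau> * (\<integral>p. \<eta> p * (y p * exp (- \<tau> * y p)) \<partial>M) \<le> k * (\<integral>p. \<eta> p * exp (- \<tau> * y p) \<partial>M)"
    and \<tau>: "0 < \<tau>" "\<tau> \<le> 1"
  shows "(\<integral>p. \<eta> p * exp (- \<tau> * y p) \<partial>M) \<le> \<tau> powr (- k) * (\<integral>p. \<eta> p * exp (- y p) \<partial>M)"
proof -
  have int: "integrable M (\<lambda>p. \<eta> p * g (y p))" if g: "continuous_on UNIV g" for g :: "real \<Rightarrow> real"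
  proof -
    have "bounded (g ` {0..S})"
      by (intro compact_imp_bounded compact_continuous_image continuous_on_subset[OF g]) auto
    then obtain B where "\<And>z. z \<in> {0..S} \<Longrightarrow> \<bar>g z\<bar> \<le> B"
      unfolding bounded_iff by (metis imageI real_norm_def)
    then have B: "\<bar>g (y p)\<bar> \<le> B" if "p \<in> K" for p using y K(3)[OF that] by simp
    have [measurable]: "g \<in> borel_measurable borel" by (rule borel_measurable_continuous_onI[OF g])
    have "norm (\<eta> p * g (y p)) \<le> B" if "p \<in> K" for p
      using mult_mono[OF \<eta>(2)[of p] B[OF that]] \<eta>(1)[of p] by (simp add: abs_mult)
    then show ?thesis
      by (intro integrableI_bounded_set[of K _ _ B] K) (auto simp: K(2))
  qed
  define J where "J \<tau> = (\<integral>p. \<eta> p * exp (- \<tau> * y p) \<partial>M)" for \<tau>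
  define J' where "J' \<tau> = (\<integral>p. \<eta> p * (y p * exp (- \<tau> * y p)) \<partial>M)" for \<tau>
  \<comment> \<open>a strictly positive bound for y on K, which keeps the range of steps h below nonempty\<close>
  define S' where "S' = max S 0 + 1"
  have S': "S' > 0" "\<And>p. p \<in> K \<Longrightarrow> y p \<le> S'" using K(3) by (force simp: S'_def)+
  have deriv: "(J has_real_derivative - J' t) (at t)" if t: "t > 0" for t
    unfolding DERIV_def
  proof (rule LIM_zero_cancel, rule Lim_null_comparison)
    have I: "integrable M (\<lambda>p. \<eta> p * exp (- \<tau> * y p))"
      "integrable M (\<lambda>p. \<eta> p * (y p * exp (- \<tau> * y p)))" for \<tau>
      by (rule int; intro continuous_intros)+
    have I\<eta>: "integrable M \<eta>" using int[of "\<lambda>z. 1"] by simp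
    have bound: "norm ((J (t + h) - J t) / h - - J' t) \<le> \<bar>h\<bar> * (S'\<^sup>2 * (\<integral>p. \<eta> p \<partial>M))"
      if h: "h \<noteq> 0" "\<bar>h\<bar> < 1 / S'" for h
    proof -
      let ?r = "\<lambda>p. \<eta> p * exp (- (t + h) * y p) - \<eta> p * exp (- t * y p)
        + h * (\<eta> p * (y p * exp (- t * y p)))"
      have r: "norm (?r p) \<le> h\<^sup>2 * S'\<^sup>2 * \<eta> p" for p
      proof (cases "p \<in> K")
        case True
        define a where "a = - h * y p"
        have "\<bar>a\<bar> \<le> \<bar>h\<bar> * S'" using S'(2)[OF True] y[of p] by (auto simp: a_def abs_mult intro: mult_left_mono)
        also have "\<dots> \<le> 1" using h(2) S'(1) by (simp add: field_simps)
        finally have a1: "\<bar>a\<bar> \<le> 1" .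
        have "0 \<le> exp a - 1 - a" using exp_ge_add_one_self[of a] by linarith
        moreover have "exp a - 1 - a \<le> a\<^sup>2"
        proof (cases "a \<ge> 0")
          case True
          then show ?thesis using a1 exp_bound[of a] by simp
        next
          case False
          then have "exp (- a) \<ge> 1 - a" "1 - a > 0" using exp_ge_add_one_self[of "- a"] by auto
          then have "exp a \<le> 1 / (1 - a)" by (simp add: exp_minus field_simps)
          also have "\<dots> \<le> 1 + a + a\<^sup>2"
          proof -
            have "(1 + a + a\<^sup>2) * (1 - a) = 1 - a * a\<^sup>2" by (simp add: algebra_simps power2_eq_square)
            moreover have "a * a\<^sup>2 \<le> 0" using False by (simp add: mult_nonpos_nonneg)
            ultimately show ?thesis using \<open>1 - a > 0\<close> by (simp add: divide_le_eq)
          qed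
          finally show ?thesis by simp
        qed
        moreover have "a\<^sup>2 \<le> h\<^sup>2 * S'\<^sup>2"
          using \<open>\<bar>a\<bar> \<le> \<bar>h\<bar> * S'\<close> power_mono[of "\<bar>a\<bar>" "\<bar>h\<bar> * S'" 2] by (simp add: power_mult_distrib)
        ultimately have "\<bar>exp a - 1 - a\<bar> \<le> h\<^sup>2 * S'\<^sup>2" by simp
        moreover have "exp (- t * y p) \<le> 1" using t y[of p] by simp
        moreover have "?r p = \<eta> p * (exp (- t * y p) * (exp a - 1 - a))"
          by (simp add: a_def algebra_simps exp_add[symmetric])
        ultimately show ?thesis using \<eta>(1)[of p]
            mult_mono[of "exp (- t * y p)" 1 "\<bar>exp a - 1 - a\<bar>" "h\<^sup>2 * S'\<^sup>2"]
          by (simp add: abs_mult mult.commute[of _ "\<eta> p"] mult_left_mono)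
      qed (simp add: K(2))
      have "J (t + h) - J t + h * J' t = (\<integral>p. ?r p \<partial>M)"
        unfolding J_def J'_def
        by (simp only: Bochner_Integration.integral_add Bochner_Integration.integral_diff
            integral_mult_right_zero I Bochner_Integration.integrable_diff integrable_mult_right)
      then have "\<bar>J (t + h) - J t + h * J' t\<bar> \<le> (\<integral>p. norm (?r p) \<partial>M)"
        by (simp only: real_norm_def[symmetric] integral_norm_bound)
      also have "\<dots> \<le> (\<integral>p. h\<^sup>2 * S'\<^sup>2 * \<eta> p \<partial>M)"
      proof (rule integral_mono[OF integrable_norm])
        show "integrable M ?r"
          by (rule Bochner_Integration.integrable_add[OF Bochner_Integration.integrable_diff[OF I(1) I(1)]
                integrable_mult_right[OF I(2)]])
        show "integrable M (\<lambda>p. h\<^sup>2 * S'\<^sup>2 * \<eta> p)" by (intro integrable_mult_right I\<eta>)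
      qed (rule r)
      finally have "\<bar>J (t + h) - J t + h * J' t\<bar> \<le> h\<^sup>2 * (S'\<^sup>2 * (\<integral>p. \<eta> p \<partial>M))" by (simp add: mult.assoc)
      moreover have "(J (t + h) - J t) / h - - J' t = (J (t + h) - J t + h * J' t) / h"
        using h by (simp add: field_simps)
      ultimately show ?thesis
        using h(1) by (simp add: abs_divide divide_le_eq power2_eq_square abs_mult mult_ac)
    qed
    have "\<forall>\<^sub>F h in at 0. h \<noteq> 0 \<and> \<bar>h\<bar> < 1 / S'"
      unfolding eventually_at using S'(1) by (intro exI[of _ "1 / S'"]) (auto simp: dist_real_def)
    then show "\<forall>\<^sub>F h in at 0. norm ((J (t + h) - J t) / h - - J' t)
        \<le> \<bar>h\<bar> * (S'\<^sup>2 * (\<integral>p. \<eta> p \<partial>M))"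
      by eventually_elim (use bound in blast)
    show "((\<lambda>h. \<bar>h\<bar> * (S'\<^sup>2 * (\<integral>p. \<eta> p \<partial>M))) \<longlongrightarrow> 0) (at 0)"
      by (rule tendsto_eq_intros tendsto_rabs refl | simp)+
  qed
  have "\<tau> powr k * J \<tau> \<le> 1 powr k * J 1"
  proof (rule DERIV_nonneg_imp_nondecreasing[OF \<tau>(2)])
    fix t assume t: "\<tau> \<le> t" "t \<le> 1"
    then have "t > 0" using \<tau> by simp
    have "((\<lambda>t. t powr k * J t) has_real_derivative
        (k * t powr (k - 1)) * J t + (- J' t) * t powr k) (at t)"
      by (intro DERIV_mult has_real_derivative_powr deriv \<open>t > 0\<close>)
    moreover have "t powr k = t powr (k - 1) * t"
      using \<open>t > 0\<close> by (simp add: powr_diff)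
    then have "(k * t powr (k - 1)) * J t + (- J' t) * t powr k
        = t powr (k - 1) * (k * J t - t * J' t)" by (simp add: algebra_simps)
    moreover have "0 \<le> t powr (k - 1) * (k * J t - t * J' t)"
      using moment[OF \<open>t > 0\<close> t(2)] by (intro mult_nonneg_nonneg) (auto simp: J_def J'_def)
    ultimately show "\<exists>y. ((\<lambda>t. t powr k * J t) has_real_derivative y) (at t) \<and> 0 \<le> y" by auto
  qed
  then have "J \<tau> \<le> \<tau> powr (- k) * J 1"
    using \<tau>(1) by (simp add: powr_minus field_simps)
  then show ?thesis by (simp add: J_def)
qed

section \<open>Area growth\<close>

text \<open>
  The lower bounds \<open>\<beta>\<close> and \<open>m\<close> take the place of the two infima in the exponent.  The number \<open>k\<close> is half of the exponent because \<open>potential\<close> grows like the square of the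
  distance.
\<close>

locale proper_lambda_hypersurface = immersed_hypersurface A X N \<mu>
  for A :: "('m::{t2_space, second_countable_topology}, 'n::finite) chart set"
    and X N :: "'m \<Rightarrow> 'e::euclidean_space" and \<mu> :: "'m measure" +
  fixes l \<beta> m k :: real and H :: "'m \<Rightarrow> real"
  assumes proper: "proper_immersion X"
    and H_def: "H = mean_curvature A X N"
    and lambda: "lambda_hypersurface A X N l"
    and \<beta>: "0 \<le> \<beta>" "\<And>p. \<beta> \<le> (l - H p)\<^sup>2 / 4"
    and m: "\<And>p. m \<le> (H p)\<^sup>2"
    and k_def: "k = (real CARD('n) + l\<^sup>2 / 2 - 2 * \<beta> - m / 2) / 2"
begin

lemma X_inner_N: "X p \<bullet> N p = l - H p"
  using lambda unfolding lambda_hypersurface_def H_def by (metis add_diff_cancel_right')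

lemma potential_grad_sq_nonneg: "0 \<le> potential_grad_sq p"
proof -
  have "N p \<bullet> N p = 1" using normal by (simp add: unit_normal_def norm_eq_1[symmetric])
  then show ?thesis using Cauchy_Schwarz_ineq[of "X p" "N p"] by (simp add: potential_grad_sq_def)
qed

lemma potential_grad_sq_le: "potential_grad_sq p \<le> potential p - \<beta>"
  using \<beta>(2)[of p] by (simp add: potential_def potential_grad_sq_def X_inner_N diff_divide_distrib)

text \<open>
  Since the potential minus \<open>\<beta>\<close> dominates the squared gradient, the left-hand side is largest at
  \<open>\<tau> = 1\<close>.  There the identity \<open>2 H (l - H) + (l - H)\<^sup>2 = l\<^sup>2 - H\<^sup>2\<close> removes the mixed terms.
\<close>

lemma drift_laplacian_le:
  assumes "0 < \<tau>" "\<tau> \<le> 1"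
  shows "potential_laplacian p - \<tau> * potential_grad_sq p + \<tau> * (potential p - \<beta>) \<le> k"
proof -
  have "\<tau> * (potential p - \<beta> - potential_grad_sq p) \<le> 1 * (potential p - \<beta> - potential_grad_sq p)"
    using potential_grad_sq_le[of p] assms by (intro mult_right_mono) auto
  then have "potential_laplacian p - \<tau> * potential_grad_sq p + \<tau> * (potential p - \<beta>)
      \<le> potential_laplacian p + (potential p - \<beta> - potential_grad_sq p)" by (simp add: algebra_simps)
  also have "\<dots> = (real CARD('n) + (l\<^sup>2 - (H p)\<^sup>2) / 2 - 2 * \<beta>) / 2"
    by (simp add: potential_laplacian_def potential_def potential_grad_sq_def H_def[symmetric] X_inner_N power2_eq_square field_simps)
  also have "\<dots> \<le> k" using m[of p] by (simp add: k_def field_simps)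
  finally show ?thesis .
qed

lemma compact_sublevel: "compact {p. potential p \<le> s}"
proof (cases "s \<ge> 0")
  case True
  have "{p. potential p \<le> s} = X -` cball 0 (sqrt (4 * s))"
    using True by (auto simp: potential_def norm_eq_sqrt_inner)
  then show ?thesis using proper by (simp add: proper_immersion_def)
next
  case False
  then have "{p. potential p \<le> s} = {}"
    using potential_nonneg by (auto simp: not_le intro: less_le_trans)
  then show ?thesis by simp
qed

lemma measurable_C1 [measurable]: "C1_fun A g \<Longrightarrow> g \<in> borel_measurable \<mu>"
  for g :: "'m \<Rightarrow> real"
  using borel_measurable_continuous_onI[OF C1_fun_continuous] by (simp add: measurable_def)

definition cutoff :: "real \<Rightarrow> 'm \<Rightarrow> real" where
  "cutoff s p = pos_square (1 - potential p / s)"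

lemma C1_cutoff: "C1_fun A (cutoff s)"
proof -
  have "C1_fun A (\<lambda>p. 1 - potential p * (1 / s))"
    by (intro C1_fun_diff C1_fun_mult C1_potential C1_fun_const)
  then have "C1_fun A (\<lambda>p. pos_square (1 - potential p * (1 / s)))"
    by (rule C1_fun_compose_real[OF _ pos_square_derivative]) (intro continuous_intros)
  then show ?thesis by (simp add: cutoff_def[abs_def])
qed

lemma cutoff_bounds:
  assumes "s > 0"
  shows "0 \<le> cutoff s p" "cutoff s p \<le> 1" "potential p > s \<Longrightarrow> cutoff s p = 0" "potential p \<le> s / 2 \<Longrightarrow> 1 / 4 \<le> cutoff s p"
proof -
  have f0: "0 \<le> potential p / s" using assms by (simp add: potential_def)
  show "0 \<le> cutoff s p" by (simp add: cutoff_def pos_square_simps)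
  show "cutoff s p \<le> 1"
    unfolding cutoff_def pos_square_def using f0 by (intro power_le_one) auto
  show "potential p > s \<Longrightarrow> cutoff s p = 0"
    using assms by (auto simp: cutoff_def divide_simps intro!: pos_square_simps(1))
  show "1 / 4 \<le> cutoff s p" if "potential p \<le> s / 2"
  proof -
    have half: "1 / 2 \<le> 1 - potential p / s" using that assms by (simp add: field_simps)
    then have "(1 / 2)\<^sup>2 \<le> (1 - potential p / s)\<^sup>2" by (intro power_mono) auto
    also have "\<dots> = cutoff s p"
      unfolding cutoff_def by (rule pos_square_simps(2)[symmetric]) (use half in linarith)
    finally show ?thesis by (simp add: power_divide)
  qed
qed

lemma integrable_cutoff:
  assumes s: "s > 0" and g: "C1_fun A g"
  shows "integrable \<mu> (\<lambda>p. cutoff s p * g p :: real)"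
proof -
  let ?K = "{p. potential p \<le> s}"
  have "compact (g ` ?K)"
    by (intro compact_continuous_image continuous_on_subset[OF C1_fun_continuous[OF g]] compact_sublevel) auto
  then obtain B where B: "\<And>p. potential p \<le> s \<Longrightarrow> \<bar>g p\<bar> \<le> B"
    by (fastforce dest: compact_imp_bounded simp: bounded_iff)
  have "norm (cutoff s p * g p) \<le> B" if "potential p \<le> s" for p
    using mult_mono[OF cutoff_bounds(2)[OF s] B[OF that], of p] cutoff_bounds(1)[OF s, of p]
    by (simp add: abs_mult)
  then show ?thesis
    using compact_sublevel emeasure_compact_finite[OF compact_sublevel] cutoff_bounds(3)[OF s]
      measurable_C1[OF C1_fun_mult[OF C1_cutoff g]]
    by (intro integrableI_bounded_set[of ?K _ _ B]) (auto simp: compact_imp_closed)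
qed

lemma C1_exp: "C1_fun A (\<lambda>p. exp (- \<tau> * (potential p - \<beta>)))"
proof -
  have "C1_fun A (\<lambda>p. (potential p - \<beta>) * (- \<tau>))"
    by (intro C1_fun_diff C1_fun_mult C1_potential C1_fun_const)
  from C1_fun_compose_real[OF this DERIV_exp]
  show ?thesis by (simp add: continuous_on_exp mult.commute)
qed

text \<open>
  The divergence theorem for the cutoff times the exponential.  Its derivative with respect to the
  potential has a negative part from the cutoff, which may be dropped, and the factor \<open>- \<tau>\<close> from the
  exponential; \<open>drift_laplacian_le\<close> bounds the remaining integrand.
\<close>

lemma weighted_moment_le:
  assumes s: "s > 0" and \<tau>: "0 < \<tau>" "\<tau> \<le> 1"
  shows "\<tau> * (\<integral>p. cutoff s p * ((potential p - \<beta>) * exp (- \<tau> * (potential p - \<beta>))) \<partial>\<mu>)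
    \<le> k * (\<integral>p. cutoff s p * exp (- \<tau> * (potential p - \<beta>)) \<partial>\<mu>)"
proof -
  define \<Phi> where "\<Phi> z = pos_square (1 - z / s) * exp (- \<tau> * (z - \<beta>))" for z
  define \<Phi>' where "\<Phi>' z = - (2 * max 0 (1 - z / s) / s) * exp (- \<tau> * (z - \<beta>)) - \<tau> * \<Phi> z" for z
  have \<Phi>_f: "\<Phi> (potential p) = cutoff s p * exp (- \<tau> * (potential p - \<beta>))" for p by (simp add: \<Phi>_def cutoff_def)
  have C1: "C1_fun A (\<lambda>p. \<Phi> (potential p))"
    unfolding \<Phi>_f by (intro C1_fun_mult C1_cutoff C1_exp)
  have d: "(\<Phi> has_real_derivative \<Phi>' z) (at z)" for z
  proof -
    have "((\<lambda>z. pos_square (1 - z / s)) has_real_derivative 2 * max 0 (1 - z / s) * (- 1 / s)) (at z)"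
      by (rule DERIV_chain2[OF pos_square_derivative]) (use s in \<open>auto intro!: derivative_eq_intros\<close>)
    moreover have "((\<lambda>z. exp (- \<tau> * (z - \<beta>))) has_real_derivative exp (- \<tau> * (z - \<beta>)) * - \<tau>) (at z)"
      by (auto intro!: derivative_eq_intros)
    ultimately show ?thesis
      unfolding \<Phi>_def \<Phi>'_def by (rule DERIV_cong[OF DERIV_mult]) (simp add: algebra_simps)
  qed
  have div: "has_bochner_integral \<mu> (\<lambda>p. \<Phi>' (potential p) * potential_grad_sq p + \<Phi> (potential p) * potential_laplacian p) 0"
  proof -
    have "has_bochner_integral \<mu> (\<lambda>p. grad_deriv (\<lambda>q. \<Phi> (potential q)) p + \<Phi> (potential p) * potential_laplacian p) 0"
      by (rule divergence_theorem[OF C1 compact_sublevel[of s]])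
         (simp add: \<Phi>_f cutoff_bounds(3)[OF s])
    then show ?thesis by (simp only: grad_deriv_of_potential[OF C1 d])
  qed
  have ptw: "\<Phi> (potential p) * (\<tau> * (potential p - \<beta>) - k) \<le> - (\<Phi>' (potential p) * potential_grad_sq p + \<Phi> (potential p) * potential_laplacian p)" for p
  proof -
    have "\<Phi>' (potential p) \<le> - \<tau> * \<Phi> (potential p)" using s by (simp add: \<Phi>'_def)
    then have "\<Phi>' (potential p) * potential_grad_sq p \<le> - \<tau> * \<Phi> (potential p) * potential_grad_sq p"
      using potential_grad_sq_nonneg by (rule mult_right_mono)
    moreover have "\<Phi> (potential p) * (potential_laplacian p - \<tau> * potential_grad_sq p + \<tau> * (potential p - \<beta>)) \<le> \<Phi> (potential p) * k"
      using drift_laplacian_le[OF \<tau>] cutoff_bounds(1)[OF s] by (intro mult_left_mono) (auto simp: \<Phi>_f)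
    ultimately show ?thesis by (simp add: algebra_simps)
  qed
  have i1: "integrable \<mu> (\<lambda>p. cutoff s p * ((potential p - \<beta>) * exp (- \<tau> * (potential p - \<beta>))))"
    and i2: "integrable \<mu> (\<lambda>p. cutoff s p * exp (- \<tau> * (potential p - \<beta>)))"
    by (intro integrable_cutoff[OF s] C1_fun_mult C1_fun_diff C1_potential C1_fun_const C1_exp)+
  have eq: "\<Phi> (potential p) * (\<tau> * (potential p - \<beta>) - k) = \<tau> * (cutoff s p * ((potential p - \<beta>) * exp (- \<tau> * (potential p - \<beta>))))
      - k * (cutoff s p * exp (- \<tau> * (potential p - \<beta>)))" for p
    unfolding \<Phi>_f by (simp only: algebra_simps)
  have "(\<integral>p. \<Phi> (potential p) * (\<tau> * (potential p - \<beta>) - k) \<partial>\<mu>)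
      \<le> (\<integral>p. - (\<Phi>' (potential p) * potential_grad_sq p + \<Phi> (potential p) * potential_laplacian p) \<partial>\<mu>)"
  proof (rule integral_mono[OF _ _ ptw])
    show "integrable \<mu> (\<lambda>p. \<Phi> (potential p) * (\<tau> * (potential p - \<beta>) - k))"
      unfolding eq by (intro Bochner_Integration.integrable_diff integrable_mult_right i1 i2)
    show "integrable \<mu> (\<lambda>p. - (\<Phi>' (potential p) * potential_grad_sq p + \<Phi> (potential p) * potential_laplacian p))"
      using div by (intro integrable_minus) (simp add: has_bochner_integral_iff)
  qed
  also have "\<dots> = 0"
    unfolding integral_minus using div by (simp add: has_bochner_integral_iff)
  finally show ?thesis
    unfolding eq
    by (simp only: Bochner_Integration.integral_diff integral_mult_right_zero integrable_mult_right i1 i2)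
qed

theorem area_growth:
  "\<exists>C>0. \<forall>r\<ge>1. emeasure \<mu> {p. norm (X p) < r} \<le> ennreal (C * r powr (2 * k))"
proof -
  let ?y = "\<lambda>p. potential p - \<beta>"
  define J where "J s \<tau> = (\<integral>p. cutoff s p * exp (- \<tau> * ?y p) \<partial>\<mu>)" for s \<tau>
  have y0: "0 \<le> ?y p" for p using potential_grad_sq_le[of p] potential_grad_sq_nonneg[of p] by linarith
  have int: "integrable \<mu> (\<lambda>p. cutoff s p * exp (- \<tau> * ?y p))" if "s > 0" for s \<tau>
    by (rule integrable_cutoff[OF that C1_exp])
  have scale: "J s \<tau> \<le> \<tau> powr (- k) * J s 1" if s: "s > 0" and \<tau>: "0 < \<tau>" "\<tau> \<le> 1" for s \<tau>
  proof -
    have "J s \<tau> \<le> \<tau> powr (- k) * (\<integral>p. cutoff s p * exp (- ?y p) \<partial>\<mu>)"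
      unfolding J_def
    proof (rule exponential_weight_bound[where K = "{p. potential p \<le> s}" and S = "s - \<beta>"])
      show "?y \<in> borel_measurable \<mu>" "cutoff s \<in> borel_measurable \<mu>"
        by (intro measurable_C1 C1_fun_diff C1_potential C1_fun_const C1_cutoff)+
      show "{p. potential p \<le> s} \<in> sets \<mu>" using compact_sublevel by (simp add: compact_imp_closed)
    qed (use emeasure_compact_finite[OF compact_sublevel] cutoff_bounds[OF s] y0 \<tau>
        weighted_moment_le[OF s] in auto)
    then show ?thesis by (simp add: J_def)
  qed
  \<comment> \<open>above the level L, halving the exponent costs a factor exp (- L / 2), small enough to absorb 2 powr k\<close>
  define L where "L = max 0 (2 * (ln 2 * (k + 1)))"
  have L: "exp (- (L / 2)) * 2 powr k \<le> 1 / 2"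
  proof -
    have "exp (- (L / 2)) \<le> exp (- (ln 2 * (k + 1)))" by (auto simp: L_def)
    also have "\<dots> = 2 powr (- (k + 1))" by (simp add: powr_def algebra_simps)
    finally have "exp (- (L / 2)) * 2 powr k \<le> 2 powr (- (k + 1)) * 2 powr k"
      by (intro mult_right_mono) auto
    also have "\<dots> = 1 / 2" by (simp add: powr_add[symmetric] powr_minus_divide)
    finally show ?thesis .
  qed
  let ?K = "{p. ?y p \<le> L}"
  have K: "compact ?K" using compact_sublevel[of "L + \<beta>"] by (simp add: diff_le_eq)
  have Ks: "?K \<in> sets \<mu>" and Kf: "emeasure \<mu> ?K < \<infinity>"
    using emeasure_compact_finite[OF K] K by (auto simp: compact_imp_closed)
  have J1: "J s 1 \<le> 2 * measure \<mu> ?K" if s: "s > 0" for s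
  proof -
    have "cutoff s p * exp (- 1 * ?y p)
        \<le> indicator ?K p + exp (- (L / 2)) * (cutoff s p * exp (- (1 / 2) * ?y p))" for p
    proof (cases "?y p \<le> L")
      case True
      have "cutoff s p * exp (- 1 * ?y p) \<le> 1 * 1"
        using y0[of p] cutoff_bounds[OF s, of p] by (intro mult_mono) auto
      moreover have "0 \<le> exp (- (L / 2)) * (cutoff s p * exp (- (1 / 2) * ?y p))"
        using cutoff_bounds(1)[OF s, of p] by simp
      ultimately show ?thesis using True by simp
    next
      case False
      have "exp (- 1 * ?y p) = exp (- (?y p / 2)) * exp (- (1 / 2) * ?y p)"
        by (simp add: exp_add[symmetric])
      also have "\<dots> \<le> exp (- (L / 2)) * exp (- (1 / 2) * ?y p)"
        using False by (intro mult_right_mono) auto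
      finally have "cutoff s p * exp (- 1 * ?y p)
          \<le> cutoff s p * (exp (- (L / 2)) * exp (- (1 / 2) * ?y p))"
        by (rule mult_left_mono[OF _ cutoff_bounds(1)[OF s]])
      then show ?thesis using False by (simp add: mult_ac)
    qed
    then have "J s 1 \<le> (\<integral>p. indicator ?K p + exp (- (L / 2)) * (cutoff s p * exp (- (1 / 2) * ?y p)) \<partial>\<mu>)"
      unfolding J_def using Ks Kf
      by (intro integral_mono Bochner_Integration.integrable_add integrable_mult_right int[OF s]) auto
    also have "\<dots> = measure \<mu> ?K + exp (- (L / 2)) * J s (1 / 2)"
      unfolding J_def using Ks Kf int[OF s, of "1/2"] by (subst Bochner_Integration.integral_add) auto
    also have "\<dots> \<le> measure \<mu> ?K + exp (- (L / 2)) * ((1 / 2) powr (- k) * J s 1)"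
      using scale[OF s, of "1/2"] by simp
    also have "(1 / 2) powr (- k) = (2::real) powr k" by (simp add: powr_minus powr_divide)
    also have "exp (- (L / 2)) * (2 powr k * J s 1) \<le> 1 / 2 * J s 1"
    proof -
      have "0 \<le> J s 1" unfolding J_def using cutoff_bounds(1)[OF s] by (intro integral_nonneg_AE) auto
      from mult_right_mono[OF L this] show ?thesis by (simp add: mult.assoc)
    qed
    finally show ?thesis by simp
  qed
  define C where "C = 8 * exp 1 * measure \<mu> ?K + 1"
  have "C > 0" unfolding C_def by (smt (verit) exp_gt_zero measure_nonneg mult_nonneg_nonneg)
  moreover have "emeasure \<mu> {p. norm (X p) < r} \<le> ennreal (C * r powr (2 * k))" if r: "r \<ge> 1" for r
  proof -
    let ?B = "{p. norm (X p) < r}"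
    define s \<tau> where "s = r\<^sup>2 / 2" and "\<tau> = 1 / r\<^sup>2"
    have s: "s > 0" and \<tau>: "0 < \<tau>" "\<tau> \<le> 1" using r by (auto simp: s_def \<tau>_def)
    have Bs: "?B \<in> sets \<mu>"
      using continuous_on_norm[OF C1_fun_continuous[OF C1_X]]
      by (simp add: open_Collect_less continuous_on_const)
    have fB: "potential p \<le> s / 2" "\<tau> * potential p \<le> 1" if "p \<in> ?B" for p
    proof -
      have "X p \<bullet> X p \<le> r\<^sup>2"
        using that power_mono[of "norm (X p)" r 2] by (simp add: power2_norm_eq_inner[symmetric])
      then have "potential p \<le> r\<^sup>2 / 4" by (simp add: potential_def)
      moreover from this have "potential p \<le> r\<^sup>2" using zero_le_power2[of r] by linarith
      ultimately show "potential p \<le> s / 2" "\<tau> * potential p \<le> 1"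
        using r by (simp_all add: s_def \<tau>_def divide_le_eq)
    qed
    have Bf: "emeasure \<mu> ?B < \<infinity>"
    proof (rule le_less_trans)
      show "emeasure \<mu> ?B \<le> emeasure \<mu> {p. potential p \<le> s / 2}"
        using fB(1) compact_sublevel[of "s / 2"] by (intro emeasure_mono) (auto simp: compact_imp_closed)
    qed (rule emeasure_compact_finite[OF compact_sublevel])
    have "indicator ?B p \<le> 4 * exp 1 * (cutoff s p * exp (- \<tau> * ?y p))" for p
    proof (cases "p \<in> ?B")
      case True
      have "\<tau> * ?y p \<le> 1"
        using fB(2)[OF True] \<tau> \<beta>(1) by (smt (verit) mult_left_mono)
      then have "1 \<le> exp 1 * exp (- \<tau> * ?y p)" by (simp add: exp_add[symmetric])
      moreover have "1 \<le> 4 * cutoff s p" using cutoff_bounds(4)[OF s fB(1)[OF True]] by simp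
      ultimately have "1 * 1 \<le> (4 * cutoff s p) * (exp 1 * exp (- \<tau> * ?y p))"
        by (intro mult_mono) auto
      then show ?thesis using True by (simp add: mult_ac)
    qed (use cutoff_bounds(1)[OF s] in simp)
    then have "(\<integral>p. indicator ?B p \<partial>\<mu>) \<le> (\<integral>p. 4 * exp 1 * (cutoff s p * exp (- \<tau> * ?y p)) \<partial>\<mu>)"
      using Bs Bf by (intro integral_mono integrable_mult_right int[OF s]) auto
    then have "measure \<mu> ?B \<le> 4 * exp 1 * J s \<tau>"
      using Bs Bf by (simp add: J_def)
    also have "\<dots> \<le> 4 * exp 1 * (\<tau> powr (- k) * (2 * measure \<mu> ?K))"
      using scale[OF s \<tau>] mult_left_mono[OF J1[OF s], of "\<tau> powr (- k)"] by (intro mult_left_mono) auto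
    also have "\<tau> powr (- k) = r powr (2 * k)"
    proof -
      have "\<tau> = r powr (- 2)" using r by (simp add: \<tau>_def powr_minus_divide powr_numeral)
      then show ?thesis by (simp add: powr_powr)
    qed
    also have "4 * exp 1 * (r powr (2 * k) * (2 * measure \<mu> ?K)) \<le> C * r powr (2 * k)"
      by (simp add: C_def algebra_simps)
    finally have "measure \<mu> ?B \<le> C * r powr (2 * k)" .
    then show ?thesis
      using Bf by (simp add: emeasure_eq_ennreal_measure ennreal_leI)
  qed
  ultimately show ?thesis by blast
qed

end

theorem theorem9p1:
  fixes A :: "('m::{t2_space, second_countable_topology}, 'n::finite) chart set"
    and X N :: "'m \<Rightarrow> real ^ 'k"
    and l \<beta> :: real
    and H :: "'m \<Rightarrow> real"
    and \<mu> :: "'m measure"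
  assumes "CARD('k) = CARD('n) + 1"
    and "smooth_atlas A"
    and "connected (UNIV :: 'm set)"
    and "\<not> compact (UNIV :: 'm set)"
    and "smooth_immersion A X"
    and "unit_normal A X N"
    and "lambda_hypersurface A X N l"
    and "complete_immersion A X"
    and "proper_immersion X"
    and "is_area_measure A X \<mu>"
    and H_def: "H = mean_curvature A X N"
    and beta_def: "\<beta> = 1 / 4 * (INF p. (l - H p)\<^sup>2)"
  shows "\<exists>C>0. \<forall>r\<ge>1. emeasure \<mu> {p. norm (X p) < r}
           \<le> ennreal (C * r powr (real CARD('n) + l\<^sup>2 / 2 - 2 * \<beta> - (INF p. (H p)\<^sup>2) / 2))"
proof -
  let ?m = "INF p. (H p)\<^sup>2"
  let ?k = "(real CARD('n) + l\<^sup>2 / 2 - 2 * \<beta> - ?m / 2) / 2"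
  interpret proper_lambda_hypersurface A X N \<mu> l \<beta> ?m ?k H
  proof
    have bdd: "bdd_below (range (\<lambda>p. (g p)\<^sup>2))" for g :: "'m \<Rightarrow> real"
      by (rule bdd_belowI[of _ 0]) auto
    have "0 \<le> (INF p. (l - H p)\<^sup>2)" by (rule cINF_greatest) auto
    then show "0 \<le> \<beta>" by (simp add: beta_def)
    show "\<beta> \<le> (l - H p)\<^sup>2 / 4" for p
      using cINF_lower[OF bdd, of p "\<lambda>p. l - H p"] by (simp add: beta_def)
    show "?m \<le> (H p)\<^sup>2" for p by (rule cINF_lower[OF bdd]) simp
  qed (use assms in auto)
  have "2 * ?k = real CARD('n) + l\<^sup>2 / 2 - 2 * \<beta> - ?m / 2" by simp
  then show ?thesis using area_growth by (simp only:)
qed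

end
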